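(* Let $m\ge3$, let $d_1,\dots,d_m\ge1$ be integers, $d=d_1+\cdots+d_m$. There is a constant $C_{m,d}$, depending only on $m$ and $d$, such that for every coordinatewise nondecreasing function $\phi\colon(0,\infty)^{m-1}\to(0,\infty)$, every $\tau=(\tau_1,\dots,\tau_m)$ with $\tau_i\in\{0,1/3,2/3\}^{d_i}$, every real-valued $f\in L^1_{\mathrm{loc}}(\mathbb R^d)$ and every $\lambda>0$, $$|\{M_{\mathcal E_\phi^\tau}f>\lambda\}|\le C_{m,d}\int_{\mathbb R^d}\frac{|f|}{\lambda}\left[\log\left(e+\frac{|f|}{\lambda}\right)\right]^{m-2},$$ where $\mathcal E_\phi^\tau$ is the family of dyadic rectangles with rounded side lengths defined in the context. In particular the constant is independent of $\phi$ and $\tau$.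
   Context: For $s>0$ put $\rho(s)=\lceil\log_2 s\rceil+2$. For $1\le i\le m$ and $a\in\{0,1/3,2/3\}^{d_i}$ let $$\mathcal D^{i,a}=\{2^k([0,1)^{d_i}+z+(-1)^ka):k\in\mathbb Z,\ z\in\mathbb Z^{d_i}\},$$ which is a dyadic grid of cubes in $\mathbb R^{d_i}$. For $\tau=(\tau_1,\dots,\tau_m)$, $\tau_i\in\{0,1/3,2/3\}^{d_i}$, let $\mathcal D_\tau=\mathcal D^{1,\tau_1}\times\cdots\times\mathcal D^{m,\tau_m}$, the family of rectangles $I=I^1\times\cdots\times I^m\subset\mathbb R^d=\mathbb R^{d_1}\times\cdots\times\mathbb R^{d_m}$ with $I^i\in\mathcal D^{i,\tau_i}$. Write $\ell(I^i)$ for the side length of the cube $I^i$. Put $$\Gamma_\phi=\{(\rho(s_1),\dots,\rho(s_{m-1}),\rho(\phi(s))):s=(s_1,\dots,s_{m-1})\in(0,\infty)^{m-1}\},$$ $$\mathcal E_\phi^\tau=\{I\in\mathcal D_\tau:(\log_2\ell(I^1),\dots,\log_2\ell(I^m))\in\Gamma_\phi\}.$$ For a rectangle family $\mathcal E$, $M_{\mathcal E}f(x)=\sup_{I\in\mathcal E,\,x\in I}|I|^{-1}\int_I|f|$ (an empty supremum is zero). Coordinatewise nondecreasing means $\phi(s)\le\phi(t)$ whenever $s_i\le t_i$ for all $i$. *)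

theory Defs
  imports "HOL-Analysis.Analysis"
begin

text \<open>
  A point of \<open>R\<^sup>n\<close> is a function in \<open>{1..n} \<rightarrow>\<^sub>E UNIV\<close>.  For a dimension vector \<open>d\<close>, a point of
  \<open>R\<^sup>d\<^sup>1 \<times> \<dots> \<times> R\<^sup>d\<^sup>m\<close> is a function \<open>x\<close> in the corresponding nested extensional function space,
  so that \<open>x i j\<close> is the \<open>j\<close>-th coordinate of the \<open>i\<close>-th block.  The completion makes the
  \<open>\<sigma>\<close>-algebra that of the Lebesgue measurable sets.
\<close>

definition leb :: "nat \<Rightarrow> (nat \<Rightarrow> nat) \<Rightarrow> (nat \<Rightarrow> nat \<Rightarrow> real) measure" where
  "leb m d = completion (\<Pi>\<^sub>M i\<in>{1..m}. \<Pi>\<^sub>M j\<in>{1..d i}. lborel)"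

text \<open>
  Compactness refers to the product topology on \<open>nat \<Rightarrow> nat \<Rightarrow> real\<close>; on \<open>space (leb m d)\<close> all
  but finitely many coordinates are frozen, so it is the Euclidean topology there.
\<close>

definition locally_integrable ::
    "nat \<Rightarrow> (nat \<Rightarrow> nat) \<Rightarrow> ((nat \<Rightarrow> nat \<Rightarrow> real) \<Rightarrow> real) \<Rightarrow> bool" where
  "locally_integrable m d f \<longleftrightarrow>
     f \<in> borel_measurable (leb m d) \<and>
     (\<forall>K. compact K \<and> K \<subseteq> space (leb m d) \<longrightarrow> set_integrable (leb m d) K f)"

definition rho :: "real \<Rightarrow> int" where
  "rho s = \<lceil>log 2 s\<rceil> + 2"

definition dyadic_cube :: "nat \<Rightarrow> (nat \<Rightarrow> real) \<Rightarrow> int \<Rightarrow> (nat \<Rightarrow> int) \<Rightarrow> (nat \<Rightarrow> real) set" where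
  "dyadic_cube n a k z =
     (\<lambda>u. \<lambda>j\<in>{1..n}. 2 powi k * (u j + of_int (z j) + (-1) powi k * a j)) ` ({1..n} \<rightarrow>\<^sub>E {0..<1})"

definition dyadic_grid :: "nat \<Rightarrow> (nat \<Rightarrow> real) \<Rightarrow> (nat \<Rightarrow> real) set set" where
  "dyadic_grid n a = {dyadic_cube n a k z |k z. True}"

definition side_length :: "nat \<Rightarrow> (nat \<Rightarrow> real) set \<Rightarrow> real" where
  "side_length n Q = (THE l. l > 0 \<and> (\<exists>c. Q = (\<Pi>\<^sub>E j\<in>{1..n}. {c j..<c j + l})))"

definition pos_orthant :: "nat \<Rightarrow> (nat \<Rightarrow> real) set" where
  "pos_orthant n = {1..n} \<rightarrow>\<^sub>E {0<..}"

definition Gamma_set :: "nat \<Rightarrow> ((nat \<Rightarrow> real) \<Rightarrow> real) \<Rightarrow> (nat \<Rightarrow> real) set" where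
  "Gamma_set m \<phi> =
     {\<lambda>i\<in>{1..m}. of_int (if i = m then rho (\<phi> s) else rho (s i)) |s. s \<in> pos_orthant (m - 1)}"

definition rect_family ::
    "nat \<Rightarrow> (nat \<Rightarrow> nat) \<Rightarrow> ((nat \<Rightarrow> real) \<Rightarrow> real) \<Rightarrow> (nat \<Rightarrow> nat \<Rightarrow> real)
       \<Rightarrow> (nat \<Rightarrow> nat \<Rightarrow> real) set set" where
  "rect_family m d \<phi> \<tau> =
     {\<Pi>\<^sub>E i\<in>{1..m}. Q i |Q.
        (\<forall>i\<in>{1..m}. Q i \<in> dyadic_grid (d i) (\<tau> i)) \<and>
        (\<lambda>i\<in>{1..m}. log 2 (side_length (d i) (Q i))) \<in> Gamma_set m \<phi>}"

definition maximal_fun ::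
    "'a measure \<Rightarrow> 'a set set \<Rightarrow> ('a \<Rightarrow> real) \<Rightarrow> 'a \<Rightarrow> ennreal" where
  "maximal_fun M E f x =
     (SUP R\<in>{R \<in> E. x \<in> R}. (\<integral>\<^sup>+y\<in>R. ennreal \<bar>f y\<bar> \<partial>M) / emeasure M R)"

definition coordwise_nondecreasing :: "nat \<Rightarrow> ((nat \<Rightarrow> real) \<Rightarrow> real) \<Rightarrow> bool" where
  "coordwise_nondecreasing n \<phi> \<longleftrightarrow>
     (\<forall>s\<in>pos_orthant n. \<forall>t\<in>pos_orthant n. (\<forall>i\<in>{1..n}. s i \<le> t i) \<longrightarrow> \<phi> s \<le> \<phi> t)"

lemma dyadic_cube_eq:
  "dyadic_cube n a k z =
     (\<Pi>\<^sub>E j\<in>{1..n}. {2 powi k * (of_int (z j) + (-1) powi k * a j)..<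
                        2 powi k * (of_int (z j) + (-1) powi k * a j) + 2 powi k})"
  (is "_ = ?R")
proof
  have p: "(2::real) powi k > 0" by simp
  show "dyadic_cube n a k z \<subseteq> ?R"
    using p by (force simp: dyadic_cube_def PiE_iff algebra_simps)
  show "?R \<subseteq> dyadic_cube n a k z"
  proof
    fix x assume x: "x \<in> ?R"
    define u where "u = (\<lambda>j\<in>{1..n}. x j / 2 powi k - of_int (z j) - (-1) powi k * a j)"
    have "u \<in> {1..n} \<rightarrow>\<^sub>E {0..<1}"
      using x p by (auto simp: u_def PiE_iff field_simps)
    moreover have "x = (\<lambda>j\<in>{1..n}. 2 powi k * (u j + of_int (z j) + (-1) powi k * a j))"
      using x p by (auto simp: u_def PiE_iff extensional_def fun_eq_iff restrict_def)
    ultimately show "x \<in> dyadic_cube n a k z"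
      unfolding dyadic_cube_def by blast
  qed
qed

lemma side_length_cube:
  assumes "n \<ge> 1" "l > 0"
  shows "side_length n (\<Pi>\<^sub>E j\<in>{1..n}. {c j..<c j + l}) = l"
  unfolding side_length_def
proof (rule the_equality)
  show "l > 0 \<and> (\<exists>c'. (\<Pi>\<^sub>E j\<in>{1..n}. {c j..<c j + l}) = (\<Pi>\<^sub>E j\<in>{1..n}. {c' j..<c' j + l}))"
    using assms by blast
next
  fix l' assume l': "l' > 0 \<and> (\<exists>c'. (\<Pi>\<^sub>E j\<in>{1..n}. {c j..<c j + l}) = (\<Pi>\<^sub>E j\<in>{1..n}. {c' j..<c' j + l'}))"
  then obtain c' where "(\<Pi>\<^sub>E j\<in>{1..n}. {c j..<c j + l}) = (\<Pi>\<^sub>E j\<in>{1..n}. {c' j..<c' j + l'})"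
    by blast
  then have "{c 1..<c 1 + l} = {c' 1..<c' 1 + l'}"
    using assms l' by (subst (asm) PiE_eq_iff_not_empty) auto
  then show "l' = l"
    using assms l' by (auto simp: atLeastLessThan_eq_iff)
qed

lemma side_length_dyadic_cube: "n \<ge> 1 \<Longrightarrow> side_length n (dyadic_cube n a k z) = 2 powi k"
  unfolding dyadic_cube_eq by (rule side_length_cube) simp_all

lemma countable_rect_family: "countable (rect_family m d \<phi> \<tau>)"
proof -
  have grid: "countable (dyadic_grid n a)" for n a
  proof -
    have "dyadic_grid n a \<subseteq> (\<lambda>(k, z). dyadic_cube n a k z) ` (UNIV \<times> ({1..n} \<rightarrow>\<^sub>E UNIV))"
    proof
      fix Q assume "Q \<in> dyadic_grid n a"
      then obtain k z where Q: "Q = dyadic_cube n a k z"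
        unfolding dyadic_grid_def by blast
      also have "\<dots> = dyadic_cube n a k (restrict z {1..n})"
        unfolding dyadic_cube_eq by (rule PiE_cong) simp
      finally have "Q = (\<lambda>(k, z). dyadic_cube n a k z) (k, restrict z {1..n})"
        by simp
      then show "Q \<in> (\<lambda>(k, z). dyadic_cube n a k z) ` (UNIV \<times> ({1..n} \<rightarrow>\<^sub>E UNIV))"
        by (rule image_eqI) simp
    qed
    moreover have "countable ((UNIV::int set) \<times> ({1..n} \<rightarrow>\<^sub>E (UNIV::int set)))"
      by (intro countable_SIGMA countable_PiE) auto
    ultimately show ?thesis
      by (meson countable_image countable_subset)
  qed
  have "rect_family m d \<phi> \<tau> \<subseteq> (\<lambda>Q. \<Pi>\<^sub>E i\<in>{1..m}. Q i) ` (\<Pi>\<^sub>E i\<in>{1..m}. dyadic_grid (d i) (\<tau> i))"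
  proof
    fix R assume "R \<in> rect_family m d \<phi> \<tau>"
    then obtain Q where "R = (\<Pi>\<^sub>E i\<in>{1..m}. Q i)" "\<forall>i\<in>{1..m}. Q i \<in> dyadic_grid (d i) (\<tau> i)"
      unfolding rect_family_def by blast
    then show "R \<in> (\<lambda>Q. \<Pi>\<^sub>E i\<in>{1..m}. Q i) ` (\<Pi>\<^sub>E i\<in>{1..m}. dyadic_grid (d i) (\<tau> i))"
      by (intro image_eqI[where x = "restrict Q {1..m}"]) (auto intro!: PiE_cong)
  qed
  moreover have "countable (\<Pi>\<^sub>E i\<in>{1..m}. dyadic_grid (d i) (\<tau> i))"
    by (intro countable_PiE grid) auto
  ultimately show ?thesis
    by (meson countable_image countable_subset)
qed

lemma rect_family_sets:
  assumes "R \<in> rect_family m d \<phi> \<tau>"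
  shows "R \<in> sets (leb m d)"
proof -
  obtain Q where R: "R = (\<Pi>\<^sub>E i\<in>{1..m}. Q i)"
    and Q: "\<And>i. i \<in> {1..m} \<Longrightarrow> Q i \<in> dyadic_grid (d i) (\<tau> i)"
    using assms unfolding rect_family_def by blast
  have "Q i \<in> sets (\<Pi>\<^sub>M j\<in>{1..d i}. lborel)" if i: "i \<in> {1..m}" for i
  proof -
    obtain k z where "Q i = dyadic_cube (d i) (\<tau> i) k z"
      using Q[OF i] unfolding dyadic_grid_def by blast
    then show ?thesis
      unfolding dyadic_cube_eq by (simp only:) (rule sets_PiM_I_finite; simp)
  qed
  then have "R \<in> sets (\<Pi>\<^sub>M i\<in>{1..m}. \<Pi>\<^sub>M j\<in>{1..d i}. lborel)"
    unfolding R by (intro sets_PiM_I_finite) auto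
  then show ?thesis
    unfolding leb_def by (rule sets_completionI_sets)
qed

text \<open>
  The level sets of the maximal function are measurable, so \<^const>\<open>emeasure\<close> does not take its
  default value \<open>0\<close> on them.
\<close>

lemma maximal_fun_level_set:
  "{x \<in> space (leb m d). maximal_fun (leb m d) (rect_family m d \<phi> \<tau>) f x > c} \<in> sets (leb m d)"
proof -
  let ?M = "leb m d"
  let ?E = "{R \<in> rect_family m d \<phi> \<tau>. (\<integral>\<^sup>+y\<in>R. ennreal \<bar>f y\<bar> \<partial>?M) / emeasure ?M R > c}"
  have "{x \<in> space ?M. maximal_fun ?M (rect_family m d \<phi> \<tau>) f x > c} = \<Union> ?E"
  proof -
    have "x \<in> space ?M" if "x \<in> R" "R \<in> rect_family m d \<phi> \<tau>" for x R
      using sets.sets_into_space[OF rect_family_sets[OF that(2)]] that(1) by blast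
    then show ?thesis
      unfolding maximal_fun_def less_SUP_iff by blast
  qed
  also have "\<dots> \<in> sets ?M"
    by (intro sets.countable_Union countable_subset[OF _ countable_rect_family])
       (auto intro: rect_family_sets)
  finally show ?thesis .
qed

end

theory Submission
  imports Defs
begin

text \<open>
  The family is made finite, \<open>f\<close> bounded, and (by splitting according to the size of the averages,
  which costs a geometric series) every rectangle \<open>R\<close> may be assumed to have average between 1
  and 2.  List the rectangles by decreasing \<open>m\<close>-th side, ties broken by the product of the other
  sides.  Monotonicity of \<open>\<phi>\<close> then says: if \<open>R\<^sub>l\<close> precedes \<open>R\<^sub>j\<close> and meets it, \<open>R\<^sub>l\<close> contains \<open>R\<^sub>j\<close> in
  direction \<open>m\<close> and in at least one further direction.  A greedy selection makes each \<open>R\<^sub>j\<close> almost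
  disjoint from its predecessors, without losing more than a constant factor of the union.

  For a point \<open>x\<close> of \<open>R\<^sub>j\<close> let \<open>a\<^sub>i(j)\<close> be the average of \<open>f\<close> over the intersection of \<open>R\<^sub>j\<close> with the
  \<open>i\<close>-th coordinate subspace through \<open>x\<close>.  With respect to \<open>f\<close>, at least half of the mass of \<open>R\<^sub>j\<close>
  sits at typical points, where the averages lie between a constant and a multiple of \<open>f(x)\<close>, where
  passing to smaller sides does not decrease \<open>a\<^sub>i\<close> by more than a factor \<open>1/b\<close>, and where each
  predecessor through \<open>x\<close> has some \<open>a\<^sub>i\<close> larger than \<open>b\<^sup>2 a\<^sub>i(j)\<close>.  Hence, for the \<open>R\<^sub>j\<close> with \<open>x\<close>
  typical, the vectors of rounded logarithms of \<open>a\<^sub>1(j), \<dots>, a\<^sub>m\<^sub>-\<^sub>1(j)\<close> stay distinct modulo the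
  diagonal, so that there are at most \<open>(C log (e + f(x)))\<^sup>m\<^sup>-\<^sup>2\<close> of them.  Summing the averages over
  the selected rectangles gives the estimate.
\<close>

declare One_nat_def [simp del] \<comment> \<open>keeps \<open>{1..m}\<close> from becoming \<open>{Suc 0..m}\<close>\<close>

subsection \<open>Integration along coordinate lines\<close>

text \<open>The inclusion-maximal members of a finite laminar family are pairwise disjoint and have
  the same union, so both integrals split into sums over them.\<close>

lemma nn_integral_laminar_le:
  fixes f h :: "'a \<Rightarrow> ennreal"
  assumes fin: "finite \<C>" and sets: "\<C> \<subseteq> sets N"
    and lam: "\<And>C D. C \<in> \<C> \<Longrightarrow> D \<in> \<C> \<Longrightarrow> C \<inter> D = {} \<or> C \<subseteq> D \<or> D \<subseteq> C"
    and f: "f \<in> borel_measurable N" and h: "h \<in> borel_measurable N"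
    and le: "\<And>C. C \<in> \<C> \<Longrightarrow> (\<integral>\<^sup>+t\<in>C. f t \<partial>N) \<le> (\<integral>\<^sup>+t\<in>C. h t \<partial>N)"
  shows "(\<integral>\<^sup>+t\<in>\<Union>\<C>. f t \<partial>N) \<le> (\<integral>\<^sup>+t\<in>\<Union>\<C>. h t \<partial>N)"
proof -
  define \<D> where "\<D> = {C \<in> \<C>. \<forall>D\<in>\<C>. \<not> C \<subset> D}"
  have finD: "finite \<D>" and DC: "\<D> \<subseteq> \<C>" using fin unfolding \<D>_def by auto
  have "\<exists>D\<in>\<D>. C \<subseteq> D" if "C \<in> \<C>" for C
  proof -
    obtain D where "D \<in> \<C>" "C \<subseteq> D" "\<forall>E\<in>\<C>. D \<subseteq> E \<longrightarrow> D = E"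
      using finite_has_maximal2[OF fin \<open>C \<in> \<C>\<close>] by blast
    then show ?thesis unfolding \<D>_def by blast
  qed
  then have U: "\<Union>\<C> = \<Union>\<D>" using DC by blast
  have disj: "C \<inter> D = {}" if "C \<in> \<D>" "D \<in> \<D>" "C \<noteq> D" for C D
    using lam[of C D] that unfolding \<D>_def by blast
  have ind: "indicator (\<Union>\<D>) t = (\<Sum>C\<in>\<D>. indicator C t :: ennreal)" for t
  proof (cases "t \<in> \<Union>\<D>")
    case True
    then obtain C where C: "C \<in> \<D>" "t \<in> C" by blast
    have "(\<Sum>C\<in>\<D>. indicator C t :: ennreal) = (\<Sum>D\<in>{C}. indicator D t)"
      using finD C disj by (intro sum.mono_neutral_right) (auto simp: indicator_def)
    then show ?thesis using C True by simp
  next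
    case False then show ?thesis by (auto simp: indicator_def intro!: sum.neutral)
  qed
  have eq: "(\<integral>\<^sup>+t\<in>\<Union>\<C>. g t \<partial>N) = (\<Sum>C\<in>\<D>. \<integral>\<^sup>+t\<in>C. g t \<partial>N)" if "g \<in> borel_measurable N" for g :: "'a \<Rightarrow> ennreal"
    unfolding U ind sum_distrib_left
    using that DC sets by (intro nn_integral_sum) (auto intro!: borel_measurable_times_ennreal borel_measurable_indicator)
  show ?thesis
    unfolding eq[OF f] eq[OF h] using le DC by (intro sum_mono) blast
qed

lemma nn_integral_Un_le:
  fixes f :: "'b \<Rightarrow> ennreal"
  assumes "f \<in> borel_measurable N" "X \<in> sets N" "Y \<in> sets N"
  shows "(\<integral>\<^sup>+x\<in>X \<union> Y. f x \<partial>N) \<le> (\<integral>\<^sup>+x\<in>X. f x \<partial>N) + (\<integral>\<^sup>+x\<in>Y. f x \<partial>N)"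
proof -
  have "(\<integral>\<^sup>+x\<in>X \<union> Y. f x \<partial>N) \<le> (\<integral>\<^sup>+x. f x * indicator X x + f x * indicator Y x \<partial>N)"
    by (intro nn_integral_mono) (auto simp: indicator_def)
  also have "\<dots> = (\<integral>\<^sup>+x\<in>X. f x \<partial>N) + (\<integral>\<^sup>+x\<in>Y. f x \<partial>N)"
    using assms by (intro nn_integral_add borel_measurable_times_ennreal borel_measurable_indicator)
  finally show ?thesis .
qed

lemma nn_integral_UN_le:
  fixes f :: "'b \<Rightarrow> ennreal"
  assumes "f \<in> borel_measurable N" "finite I" "\<And>i. i \<in> I \<Longrightarrow> X i \<in> sets N"
  shows "(\<integral>\<^sup>+x\<in>(\<Union>i\<in>I. X i). f x \<partial>N) \<le> (\<Sum>i\<in>I. \<integral>\<^sup>+x\<in>X i. f x \<partial>N)"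
  using assms(2,3)
proof (induction I)
  case (insert i I)
  have "(\<integral>\<^sup>+x\<in>X i \<union> (\<Union>i\<in>I. X i). f x \<partial>N) \<le> (\<integral>\<^sup>+x\<in>X i. f x \<partial>N) + (\<integral>\<^sup>+x\<in>(\<Union>i\<in>I. X i). f x \<partial>N)"
    using insert.prems insert.hyps(1) by (intro nn_integral_Un_le assms(1) sets.finite_UN) auto
  also have "\<dots> \<le> (\<integral>\<^sup>+x\<in>X i. f x \<partial>N) + (\<Sum>i\<in>I. \<integral>\<^sup>+x\<in>X i. f x \<partial>N)"
    using insert by (intro add_left_mono) auto
  finally show ?case using insert.hyps by simp
qed simp

locale finite_product = product_sigma_finite M for M :: "nat \<Rightarrow> 'a measure" +
  fixes m :: nat
begin

abbreviation P where "P \<equiv> \<Pi>\<^sub>M i\<in>{1..m}. M i"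

text \<open>The value ignores \<open>x i\<close> but remains a function of the whole point, so that
  all partial integrals live on the one space \<open>P\<close> and can be compared there.\<close>

definition line_int :: "nat \<Rightarrow> 'a set \<Rightarrow> ((nat \<Rightarrow> 'a) \<Rightarrow> ennreal) \<Rightarrow> (nat \<Rightarrow> 'a) \<Rightarrow> ennreal" where
  "line_int i A f x = (\<integral>\<^sup>+t\<in>A. f (x(i := t)) \<partial>M i)"

lemma upd_measurable: "i \<in> {1..m} \<Longrightarrow> (\<lambda>(x, t). x(i := t)) \<in> measurable (P \<Otimes>\<^sub>M M i) P"
  using measurable_add_dim[of i "{1..m}" M] by (simp add: insert_absorb split_def)

lemma upd_space: "i \<in> {1..m} \<Longrightarrow> x \<in> space P \<Longrightarrow> t \<in> space (M i) \<Longrightarrow> x(i := t) \<in> space P"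
  by (auto simp: space_PiM PiE_iff extensional_def)

lemma line_measurable:
  assumes "i \<in> {1..m}" "f \<in> measurable P N" "x \<in> space P"
  shows "(\<lambda>t. f (x(i := t))) \<in> measurable (M i) N"
proof -
  have "(\<lambda>t. (x, t)) \<in> measurable (M i) (P \<Otimes>\<^sub>M M i)" using assms(3) by simp
  from measurable_comp[OF this measurable_comp[OF upd_measurable[OF assms(1)] assms(2)]]
  show ?thesis by (simp add: comp_def)
qed

lemma line_int_measurable [measurable]:
  assumes "i \<in> {1..m}" "f \<in> borel_measurable P" "A \<in> sets (M i)"
  shows "line_int i A f \<in> borel_measurable P"
proof -
  interpret sigma_finite_measure "M i" by (rule sigma_finite_measures)
  have [measurable]: "A \<in> sets (M i)" by fact
  have [measurable]: "(\<lambda>(x, t). f (x(i := t))) \<in> borel_measurable (P \<Otimes>\<^sub>M M i)"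
    using measurable_comp[OF upd_measurable[OF assms(1)] assms(2)] by (simp add: comp_def split_def)
  have "(\<lambda>x. \<integral>\<^sup>+t. (\<lambda>(x, t). f (x(i := t)) * indicator A t) (x, t) \<partial>M i) \<in> borel_measurable P"
    by (rule borel_measurable_nn_integral_fst) measurable
  then show ?thesis unfolding line_int_def[abs_def] by simp
qed

lemma nn_integral_line_mono:
  assumes i: "i \<in> {1..m}" and f: "f \<in> borel_measurable P" and h: "h \<in> borel_measurable P"
    and le: "\<And>x. x \<in> space P \<Longrightarrow> (\<integral>\<^sup>+t. f (x(i := t)) \<partial>M i) \<le> (\<integral>\<^sup>+t. h (x(i := t)) \<partial>M i)"
  shows "(\<integral>\<^sup>+x. f x \<partial>P) \<le> (\<integral>\<^sup>+x. h x \<partial>P)"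
proof -
  define J where "J = {1..m} - {i}"
  have ins: "{1..m} = insert i J" and fin: "finite J" and ni: "i \<notin> J" using i by (auto simp: J_def)
  have eq: "(\<integral>\<^sup>+x. g x \<partial>P) = (\<integral>\<^sup>+x. \<integral>\<^sup>+t. g (x(i := t)) \<partial>M i \<partial>(\<Pi>\<^sub>M i\<in>J. M i))"
    if "g \<in> borel_measurable P" for g :: "(nat \<Rightarrow> 'a) \<Rightarrow> ennreal"
    using product_nn_integral_insert[OF fin ni, of g] that unfolding ins by simp
  have "(\<integral>\<^sup>+t. f (x(i := t)) \<partial>M i) \<le> (\<integral>\<^sup>+t. h (x(i := t)) \<partial>M i)" if x: "x \<in> space (\<Pi>\<^sub>M i\<in>J. M i)" for x
  \<comment> \<open>\<open>x\<close> has no coordinate \<open>i\<close>, while \<open>le\<close>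
    asks for a point of \<open>P\<close>. Any \<open>t0\<close> fills the gap, since the update
    overwrites it.\<close>
  proof (cases "space (M i) = {}")
    case True then show ?thesis by (intro eq_refl nn_integral_cong) auto
  next
    case False
    then obtain t0 where t0: "t0 \<in> space (M i)" by blast
    have "x(i := t0) \<in> space P" using x t0 unfolding ins by (auto simp: space_PiM PiE_iff extensional_def)
    from le[OF this] show ?thesis by simp
  qed
  then show ?thesis unfolding eq[OF f] eq[OF h] by (rule nn_integral_mono)
qed

text \<open>
  All covering arguments reduce to this one-dimensional principle: on a coordinate line the maximal
  sets of a laminar family are disjoint, so the comparison on single sets sums up.
\<close>

lemma line_laminar:
  assumes i: "i \<in> {1..m}" and f: "f \<in> borel_measurable P" and h: "h \<in> borel_measurable P"
    and E: "E \<in> sets P" and E': "E' \<in> sets P"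
    and fin: "finite \<G>" and sets: "\<G> \<subseteq> sets (M i)"
    and lam: "\<And>C D. C \<in> \<G> \<Longrightarrow> D \<in> \<G> \<Longrightarrow> C \<inter> D = {} \<or> C \<subseteq> D \<or> D \<subseteq> C"
    and ex: "\<And>x. x \<in> E \<Longrightarrow> \<exists>C\<in>\<G>. x i \<in> C \<and> (\<forall>t\<in>C. x(i := t) \<in> E') \<and> line_int i C f x \<le> line_int i C h x"
  shows "(\<integral>\<^sup>+x\<in>E. f x \<partial>P) \<le> (\<integral>\<^sup>+x\<in>E'. h x \<partial>P)"
proof (rule nn_integral_line_mono[OF i])
  show "(\<lambda>x. f x * indicator E x) \<in> borel_measurable P" "(\<lambda>x. h x * indicator E' x) \<in> borel_measurable P"
    using f h E E' by (auto intro!: borel_measurable_times_ennreal borel_measurable_indicator)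
  fix x assume x: "x \<in> space P"
  \<comment> \<open>Whether a set qualifies does not change along the line, so this subfamily serves
    all points of the line through \<open>x\<close>.\<close>
  define \<C> where "\<C> = {C \<in> \<G>. (\<forall>t\<in>C. x(i := t) \<in> E') \<and> line_int i C f x \<le> line_int i C h x}"
  have CG: "\<C> \<subseteq> \<G>" by (auto simp: \<C>_def)
  have cover: "t \<in> \<Union>\<C>" if "x(i := t) \<in> E" for t
  proof -
    obtain C where "C \<in> \<G>" "t \<in> C" "\<forall>s\<in>C. x(i := s) \<in> E'" "line_int i C f (x(i := t)) \<le> line_int i C h (x(i := t))"
      using ex[OF \<open>x(i := t) \<in> E\<close>] by auto
    moreover from this have "C \<in> \<C>" by (simp add: \<C>_def line_int_def)
    ultimately show ?thesis by blast
  qed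
  have "(\<integral>\<^sup>+t. f (x(i := t)) * indicator E (x(i := t)) \<partial>M i) \<le> (\<integral>\<^sup>+t\<in>\<Union>\<C>. f (x(i := t)) \<partial>M i)"
    using cover by (intro nn_integral_mono) (auto simp: indicator_def)
  also have "\<dots> \<le> (\<integral>\<^sup>+t\<in>\<Union>\<C>. h (x(i := t)) \<partial>M i)"
  proof (rule nn_integral_laminar_le)
    show "finite \<C>" "\<C> \<subseteq> sets (M i)" using CG fin sets by (auto intro: finite_subset)
    show "(\<lambda>t. f (x(i := t))) \<in> borel_measurable (M i)" "(\<lambda>t. h (x(i := t))) \<in> borel_measurable (M i)"
      using line_measurable[OF i f x] line_measurable[OF i h x] by auto
  qed (use CG lam in \<open>auto simp: \<C>_def line_int_def\<close>)
  also have "\<dots> \<le> (\<integral>\<^sup>+t. h (x(i := t)) * indicator E' (x(i := t)) \<partial>M i)"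
    by (intro nn_integral_mono) (auto simp: indicator_def \<C>_def)
  finally show "(\<integral>\<^sup>+t. f (x(i := t)) * indicator E (x(i := t)) \<partial>M i)
      \<le> (\<integral>\<^sup>+t. h (x(i := t)) * indicator E' (x(i := t)) \<partial>M i)" .
qed

lemma line_int_upd [simp]: "line_int i A f (x(i := t)) = line_int i A f x"
  by (simp add: line_int_def)

lemma line_int_invariant:
  assumes "\<And>t. g (x(i := t)) = c" "A \<in> sets (M i)"
  shows "line_int i A g x = c * emeasure (M i) A"
  using assms by (simp add: line_int_def nn_integral_cmult_indicator)

lemma line_int_cmult:
  assumes "i \<in> {1..m}" "f \<in> borel_measurable P" "x \<in> space P" "A \<in> sets (M i)" "\<And>t. g (x(i := t)) = c"
  shows "line_int i A (\<lambda>x. g x * f x) x = c * line_int i A f x"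
proof -
  have "(\<lambda>t. f (x(i := t)) * indicator A t) \<in> borel_measurable (M i)"
    using line_measurable[OF assms(1-3)] assms(4) by (auto intro!: borel_measurable_times_ennreal borel_measurable_indicator)
  then show ?thesis
    unfolding line_int_def assms(5) by (simp add: mult.assoc nn_integral_cmult)
qed

lemma line_int_mono_set: "A \<subseteq> B \<Longrightarrow> line_int i A f x \<le> line_int i B f x"
  unfolding line_int_def by (intro nn_integral_mono) (auto simp: indicator_def)

lemma line_int_le_cmult:
  assumes "\<And>x. f x \<le> c" "A \<in> sets (M i)"
  shows "line_int i A f x \<le> c * emeasure (M i) A"
proof -
  have "line_int i A f x \<le> (\<integral>\<^sup>+t. c * indicator A t \<partial>M i)"
    unfolding line_int_def using assms by (intro nn_integral_mono mult_right_mono) auto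
  then show ?thesis using assms by (simp add: nn_integral_cmult_indicator)
qed

section \<open>Rectangles and iterated averages\<close>

definition rect :: "(nat \<Rightarrow> 'a set) \<Rightarrow> (nat \<Rightarrow> 'a) set" where
  "rect A = (\<Pi>\<^sub>E i\<in>{1..m}. A i)"

lemma rect_upd: "x \<in> rect A \<Longrightarrow> i \<in> {1..m} \<Longrightarrow> t \<in> A i \<Longrightarrow> x(i := t) \<in> rect A"
  by (auto simp: rect_def PiE_iff extensional_def)

lemma rect_mem: "x \<in> rect A \<Longrightarrow> i \<in> {1..m} \<Longrightarrow> x i \<in> A i"
  by (auto simp: rect_def)

text \<open>With \<open>f\<close> regarded as a density on the rectangle, stage \<open>k\<close> is
  the marginal density after averaging out the directions 1 to \<open>k\<close>, and stage
  \<open>m\<close> is the mean of \<open>f\<close>. Every stage is again a function of a full point,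
  constant in the averaged coordinates.\<close>

primrec iter_avg :: "(nat \<Rightarrow> 'a set) \<Rightarrow> ((nat \<Rightarrow> 'a) \<Rightarrow> ennreal) \<Rightarrow> nat \<Rightarrow> (nat \<Rightarrow> 'a) \<Rightarrow> ennreal" where
  "iter_avg A f 0 = f"
| "iter_avg A f (Suc k) = (\<lambda>x. line_int (Suc k) (A (Suc k)) (iter_avg A f k) x / emeasure (M (Suc k)) (A (Suc k)))"

lemma iter_avg_upd: "k \<in> {1..n} \<Longrightarrow> iter_avg A f n (x(k := t)) = iter_avg A f n x"
proof (induction n arbitrary: x)
  case (Suc n)
  show ?case
  proof (cases "k = Suc n")
    case False
    then have k: "k \<in> {1..n}" using Suc.prems by auto
    have "iter_avg A f n ((x(k := t))(Suc n := s)) = iter_avg A f n (x(Suc n := s))" for s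
      unfolding fun_upd_twist[OF False] by (rule Suc.IH[OF k])
    then have "line_int (Suc n) (A (Suc n)) (iter_avg A f n) (x(k := t)) = line_int (Suc n) (A (Suc n)) (iter_avg A f n) x"
      unfolding line_int_def by simp
    then show ?thesis by (simp only: iter_avg.simps)
  qed (simp only: iter_avg.simps line_int_upd)
qed simp

text \<open>The coordinates of \<open>x\<close> are exchanged for those of \<open>y\<close> one at a
  time; each exchange is an update that \<open>iter_avg_upd\<close> ignores.\<close>

lemma iter_avg_const:
  assumes "x \<in> extensional {1..m}" "y \<in> extensional {1..m}"
  shows "iter_avg A f m x = iter_avg A f m y"
proof -
  have "iter_avg A f m (\<lambda>i. if i \<in> {1..n} then y i else x i) = iter_avg A f m x" if "n \<le> m" for n
    using that
  proof (induction n)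
    case (Suc n)
    have mem: "Suc n \<in> {1..m}" using Suc.prems by auto
    have "(\<lambda>i. if i \<in> {1..Suc n} then y i else x i) = (\<lambda>i. if i \<in> {1..n} then y i else x i)(Suc n := y (Suc n))"
      by (auto simp: fun_eq_iff)
    then have "iter_avg A f m (\<lambda>i. if i \<in> {1..Suc n} then y i else x i) =
        iter_avg A f m ((\<lambda>i. if i \<in> {1..n} then y i else x i)(Suc n := y (Suc n)))"
      by (simp only:)
    also have "\<dots> = iter_avg A f m (\<lambda>i. if i \<in> {1..n} then y i else x i)"
      by (rule iter_avg_upd[OF mem])
    also have "\<dots> = iter_avg A f m x" using Suc by (simp only: Suc_leD)
    finally show ?case .
  qed simp
  from this[of m] have "iter_avg A f m (\<lambda>i. if i \<in> {1..m} then y i else x i) = iter_avg A f m x" by simp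
  moreover have "(\<lambda>i. if i \<in> {1..m} then y i else x i) = y"
    using assms by (auto simp: fun_eq_iff extensional_def)
  ultimately show ?thesis by simp
qed

end

locale product_rect = finite_product +
  fixes A :: "nat \<Rightarrow> 'a set"
  assumes A_sets [measurable]: "i \<in> {1..m} \<Longrightarrow> A i \<in> sets (M i)"
    and A_pos: "i \<in> {1..m} \<Longrightarrow> emeasure (M i) (A i) > 0"
    and A_fin: "i \<in> {1..m} \<Longrightarrow> emeasure (M i) (A i) < \<infinity>"
begin

lemma rect_sets [measurable]: "rect A \<in> sets P"
  unfolding rect_def using A_sets by (intro sets_PiM_I_finite) auto

lemma divide_times_A:
  assumes "i \<in> {1..m}"
  shows "c / emeasure (M i) (A i) * emeasure (M i) (A i) = c"
proof -
  have "emeasure (M i) (A i) / emeasure (M i) (A i) = 1"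
    using A_pos[OF assms] A_fin[OF assms] by (intro ennreal_divide_self) auto
  then show ?thesis unfolding ennreal_divide_times by simp
qed

lemma le_divide_A: assumes i: "i \<in> {1..m}"
  shows "c \<le> d / emeasure (M i) (A i) \<longleftrightarrow> c * emeasure (M i) (A i) \<le> d"
proof
  assume "c \<le> d / emeasure (M i) (A i)"
  then have "c * emeasure (M i) (A i) \<le> d / emeasure (M i) (A i) * emeasure (M i) (A i)"
    by (rule mult_right_mono) simp
  then show "c * emeasure (M i) (A i) \<le> d" by (simp only: divide_times_A[OF i])
next
  assume "c * emeasure (M i) (A i) \<le> d"
  then have "c * emeasure (M i) (A i) / emeasure (M i) (A i) \<le> d / emeasure (M i) (A i)"
    by (rule divide_right_mono_ennreal)
  moreover have "c * emeasure (M i) (A i) / emeasure (M i) (A i) = c"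
    using A_pos[OF i] A_fin[OF i] by (intro ennreal_mult_divide_eq) auto
  ultimately show "c \<le> d / emeasure (M i) (A i)" by simp
qed

lemma iter_avg_measurable:
  assumes "f \<in> borel_measurable P" "k \<le> m"
  shows "iter_avg A f k \<in> borel_measurable P"
  using assms(2)
proof (induction k)
  case (Suc k)
  then have "line_int (Suc k) (A (Suc k)) (iter_avg A f k) \<in> borel_measurable P"
    by (intro line_int_measurable A_sets) auto
  then show ?case by simp
qed (use assms in simp)

lemma iter_avg_le:
  assumes "\<And>x. f x \<le> c" "k \<le> m"
  shows "iter_avg A f k x \<le> c"
  using assms(2)
proof (induction k arbitrary: x)
  case (Suc k)
  then have "line_int (Suc k) (A (Suc k)) (iter_avg A f k) x \<le> c * emeasure (M (Suc k)) (A (Suc k))"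
    by (intro line_int_le_cmult A_sets) auto
  then have "iter_avg A f (Suc k) x \<le> c * emeasure (M (Suc k)) (A (Suc k)) / emeasure (M (Suc k)) (A (Suc k))"
    by (auto intro: divide_right_mono_ennreal)
  also have "\<dots> = c" using A_pos[of "Suc k"] A_fin[of "Suc k"] Suc by (intro ennreal_mult_divide_eq) auto
  finally show ?case .
qed (use assms in simp)

lemma nn_integral_rect_mono:
  assumes i: "i \<in> {1..m}" and f: "f \<in> borel_measurable P" and h: "h \<in> borel_measurable P"
    and le: "\<And>x. x \<in> rect A \<Longrightarrow> line_int i (A i) f x \<le> line_int i (A i) h x"
  shows "(\<integral>\<^sup>+x\<in>rect A. f x \<partial>P) \<le> (\<integral>\<^sup>+x\<in>rect A. h x \<partial>P)"
proof (rule line_laminar[OF i f h, where \<G> = "{A i}"])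
  fix x assume "x \<in> rect A"
  then show "\<exists>C\<in>{A i}. x i \<in> C \<and> (\<forall>t\<in>C. x(i := t) \<in> rect A) \<and> line_int i C f x \<le> line_int i C h x"
    using le i rect_upd rect_mem by auto
qed (use A_sets i in auto)

lemma line_avg_measurable:
  "i \<in> {1..m} \<Longrightarrow> f \<in> borel_measurable P \<Longrightarrow> (\<lambda>x. line_int i (A i) f x / emeasure (M i) (A i)) \<in> borel_measurable P"
  using line_int_measurable[of i f "A i"] A_sets by simp

text \<open>Along a line the average is constant, so its integral over the side restores that of
  \<open>f\<close>; both inequalities then follow line by line.\<close>

lemma nn_integral_line_avg:
  assumes i: "i \<in> {1..m}" and f: "f \<in> borel_measurable P"
  shows "(\<integral>\<^sup>+x\<in>rect A. line_int i (A i) f x / emeasure (M i) (A i) \<partial>P) = (\<integral>\<^sup>+x\<in>rect A. f x \<partial>P)"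
proof -
  have "line_int i (A i) (\<lambda>x. line_int i (A i) f x / emeasure (M i) (A i)) x = line_int i (A i) f x" for x
    using i by (subst line_int_invariant) (auto simp: divide_times_A A_sets)
  then show ?thesis
    using line_avg_measurable[OF i f] f i by (intro antisym nn_integral_rect_mono) auto
qed

lemma nn_integral_iter_avg:
  assumes "f \<in> borel_measurable P" "k \<le> m"
  shows "(\<integral>\<^sup>+x\<in>rect A. iter_avg A f k x \<partial>P) = (\<integral>\<^sup>+x\<in>rect A. f x \<partial>P)"
  using assms(2)
proof (induction k)
  case (Suc k)
  then show ?case
    using nn_integral_line_avg[of "Suc k" "iter_avg A f k"] iter_avg_measurable[OF assms(1), of k] by simp
qed simp

lemma emeasure_rect: "(\<integral>\<^sup>+x\<in>rect A. c \<partial>P) = c * emeasure P (rect A)"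
  by (simp add: nn_integral_cmult_indicator)

lemma emeasure_rect_prod: "emeasure P (rect A) = (\<Prod>i\<in>{1..m}. emeasure (M i) (A i))"
  unfolding rect_def using A_sets by (intro emeasure_PiM) auto

lemma emeasure_rect_pos: "emeasure P (rect A) > 0"
proof -
  have "emeasure (M i) (A i) \<noteq> 0" if "i \<in> {1..m}" for i
    using A_pos[OF that] by (simp only: less_numeral_extra not_gr_zero)
  then show ?thesis unfolding emeasure_rect_prod zero_less_iff_neq_zero ennreal_prod_eq_0 by blast
qed

lemma emeasure_rect_finite: "emeasure P (rect A) < \<infinity>"
proof -
  have "emeasure (M i) (A i) \<noteq> top" if "i \<in> {1..m}" for i
    using A_fin[OF that] by (simp add: less_top)
  then have "(\<Prod>i\<in>{1..m}. emeasure (M i) (A i)) \<noteq> top"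
    unfolding ennreal_prod_eq_top by blast
  then show ?thesis unfolding emeasure_rect_prod by (simp add: less_top)
qed

text \<open>The integral is preserved through all \<open>m\<close> stages, and the last stage is
  constant on the rectangle.\<close>

lemma iter_avg_full:
  assumes "f \<in> borel_measurable P" "x \<in> rect A"
  shows "iter_avg A f m x * emeasure P (rect A) = (\<integral>\<^sup>+x\<in>rect A. f x \<partial>P)"
proof -
  have "(\<integral>\<^sup>+x\<in>rect A. f x \<partial>P) = (\<integral>\<^sup>+y\<in>rect A. iter_avg A f m y \<partial>P)"
    using nn_integral_iter_avg[OF assms(1)] by simp
  also have "\<dots> = (\<integral>\<^sup>+y\<in>rect A. iter_avg A f m x \<partial>P)"
  proof (rule nn_integral_cong)
    fix y
    show "iter_avg A f m y * indicator (rect A) y = iter_avg A f m x * indicator (rect A) y"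
    proof (cases "y \<in> rect A")
      case True
      then have "iter_avg A f m y = iter_avg A f m x"
        using assms(2) by (intro iter_avg_const) (auto simp: rect_def PiE_iff)
      then show ?thesis by (simp only:)
    qed simp
  qed
  finally show ?thesis by (simp add: emeasure_rect)
qed

end

subsection \<open>Typical points of a rectangle\<close>

text \<open>\<open>A\<close> is the rectangle whose points are examined, \<open>Q\<close> the family
  it is compared with. Laminarity is demanded in each direction separately, because rectangles with
  nested sides may still cross each other.\<close>

locale rect_in_family = product_rect +
  fixes J :: "nat set" and Q :: "nat \<Rightarrow> nat \<Rightarrow> 'a set"
  assumes J_fin: "finite J"
    and Q_sets [measurable]: "l \<in> J \<Longrightarrow> i \<in> {1..m} \<Longrightarrow> Q l i \<in> sets (M i)"
    and Q_laminar: "l \<in> J \<Longrightarrow> k \<in> J \<Longrightarrow> i \<in> {1..m} \<Longrightarrow> Q l i \<inter> Q k i = {} \<or> Q l i \<subseteq> Q k i \<or> Q k i \<subseteq> Q l i"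
begin

declare iter_avg.simps(2) [simp del]

section \<open>Exceptional sets of small mass\<close>

lemma C_sets: "l \<in> J \<Longrightarrow> i \<in> {1..m} \<Longrightarrow> Q l i \<inter> A i \<in> sets (M i)"
  using Q_sets A_sets by blast

lemma component_sets: "l \<in> J \<Longrightarrow> i \<in> {1..m} \<Longrightarrow> {x \<in> space P. x i \<in> Q l i} \<in> sets P"
  using Q_sets by (intro measurable_sets_Collect[OF measurable_component_singleton]) auto

text \<open>Membership in \<open>E\<close> depends only on the line in direction \<open>i\<close>,
  and on such a line \<open>f\<close> integrates to less than the constant \<open>\<eta>\<close>
  does.\<close>

lemma low_line_mass:
  fixes \<eta> :: ennreal
  assumes i: "i \<in> {1..m}" and f: "f \<in> borel_measurable P"
  defines "E \<equiv> {x \<in> rect A. line_int i (A i) f x < \<eta> * emeasure (M i) (A i)}"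
  shows "E \<in> sets P" "(\<integral>\<^sup>+x\<in>E. f x \<partial>P) \<le> \<eta> * emeasure P (rect A)"
proof -
  have [measurable]: "line_int i (A i) f \<in> borel_measurable P"
    using i f A_sets by (intro line_int_measurable) auto
  have "E = rect A \<inter> {x \<in> space P. line_int i (A i) f x < \<eta> * emeasure (M i) (A i)}"
    using sets.sets_into_space[OF rect_sets] by (auto simp: E_def)
  also have "\<dots> \<in> sets P" by measurable
  finally show E: "E \<in> sets P" .
  have "(\<integral>\<^sup>+x\<in>E. f x \<partial>P) \<le> (\<integral>\<^sup>+x\<in>rect A. \<eta> \<partial>P)"
  proof (rule line_laminar[OF i f _ E rect_sets, where \<G> = "{A i}"])
    fix x assume x: "x \<in> E"
    then have "line_int i (A i) f x \<le> line_int i (A i) (\<lambda>_. \<eta>) x"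
      using i A_sets by (subst line_int_invariant[where c = \<eta>]) (auto simp: E_def)
    then show "\<exists>C\<in>{A i}. x i \<in> C \<and> (\<forall>t\<in>C. x(i := t) \<in> rect A) \<and> line_int i C f x \<le> line_int i C (\<lambda>_. \<eta>) x"
      using x i rect_upd rect_mem by (auto simp: E_def)
  qed (use A_sets i in auto)
  then show "(\<integral>\<^sup>+x\<in>E. f x \<partial>P) \<le> \<eta> * emeasure P (rect A)" by (simp only: emeasure_rect)
qed

text \<open>On \<open>E\<close> the function is below \<open>\<eta>\<close> times its line average,
  and averaging along lines preserves the integral over the rectangle.\<close>

lemma low_point_mass:
  fixes \<eta> :: ennreal
  assumes i: "i \<in> {1..m}" and f: "f \<in> borel_measurable P"
  defines "E \<equiv> {x \<in> rect A. f x * emeasure (M i) (A i) < \<eta> * line_int i (A i) f x}"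
  shows "E \<in> sets P" "(\<integral>\<^sup>+x\<in>E. f x \<partial>P) \<le> \<eta> * (\<integral>\<^sup>+x\<in>rect A. f x \<partial>P)"
proof -
  have [measurable]: "line_int i (A i) f \<in> borel_measurable P"
    using i f A_sets by (intro line_int_measurable) auto
  note f [measurable]
  have "E = rect A \<inter> {x \<in> space P. f x * emeasure (M i) (A i) < \<eta> * line_int i (A i) f x}"
    using sets.sets_into_space[OF rect_sets] by (auto simp: E_def)
  also have "\<dots> \<in> sets P" by measurable
  finally show E: "E \<in> sets P" .
  have "(\<integral>\<^sup>+x\<in>E. f x \<partial>P) \<le> (\<integral>\<^sup>+x\<in>rect A. \<eta> * (line_int i (A i) f x / emeasure (M i) (A i)) \<partial>P)"
  proof (intro nn_integral_mono)
    fix x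
    show "f x * indicator E x \<le> \<eta> * (line_int i (A i) f x / emeasure (M i) (A i)) * indicator (rect A) x"
    proof (cases "x \<in> E")
      case True
      then have "f x \<le> \<eta> * line_int i (A i) f x / emeasure (M i) (A i)"
        unfolding le_divide_A[OF i] by (auto simp: E_def)
      then show ?thesis using True by (simp add: E_def ennreal_times_divide)
    qed simp
  qed
  also have "\<dots> = \<eta> * (\<integral>\<^sup>+x\<in>rect A. line_int i (A i) f x / emeasure (M i) (A i) \<partial>P)"
    unfolding mult.assoc using line_avg_measurable[OF i f] rect_sets
    by (intro nn_integral_cmult borel_measurable_times_ennreal borel_measurable_indicator)
  also have "\<dots> = \<eta> * (\<integral>\<^sup>+x\<in>rect A. f x \<partial>P)" by (simp only: nn_integral_line_avg[OF i f])
  finally show "(\<integral>\<^sup>+x\<in>E. f x \<partial>P) \<le> \<eta> * (\<integral>\<^sup>+x\<in>rect A. f x \<partial>P)" .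
qed

text \<open>
  Applied with \<open>g\<close> a partial average of \<open>f\<close>: for most of the mass, a set of the family is not much
  less likely conditionally on the remaining coordinates than it is in the marginal distribution.
\<close>

lemma transfer_mass:
  fixes \<eta> :: ennreal
  assumes i: "i \<in> {1..m}" and f: "f \<in> borel_measurable P" and g: "g \<in> borel_measurable P"
    and gfin: "\<And>x. line_int i (A i) g x < \<infinity>"
  defines "E \<equiv> {x \<in> rect A. \<exists>l\<in>J. x i \<in> Q l i \<and>
    line_int i (Q l i \<inter> A i) f x * line_int i (A i) g x < \<eta> * line_int i (Q l i \<inter> A i) g x * line_int i (A i) f x}"
  shows "E \<in> sets P" "(\<integral>\<^sup>+x\<in>E. f x \<partial>P) \<le> \<eta> * (\<integral>\<^sup>+x\<in>rect A. f x \<partial>P)"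
proof -
  have [measurable]: "line_int i (A i) f \<in> borel_measurable P" "line_int i (A i) g \<in> borel_measurable P"
    using i f g A_sets by (auto intro!: line_int_measurable)
  note f [measurable] g [measurable]
  \<comment> \<open>\<open>h\<close> is \<open>g\<close> rescaled on every line: its integral over
    \<open>A i\<close> is at most \<open>\<eta>\<close> times that of \<open>f\<close>, yet over the
    sets \<open>C\<close> that put a point into \<open>E\<close> it dominates the integral of
    \<open>f\<close>.\<close>
  define h where "h x = \<eta> * (line_int i (A i) f x / line_int i (A i) g x) * g x" for x
  have h [measurable]: "h \<in> borel_measurable P" unfolding h_def by measurable
  have "E = (\<Union>l\<in>J. rect A \<inter> ({x \<in> space P. x i \<in> Q l i} \<inter> {x \<in> space P. line_int i (Q l i \<inter> A i) f x * line_int i (A i) g x < \<eta> * line_int i (Q l i \<inter> A i) g x * line_int i (A i) f x}))"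
    using sets.sets_into_space[OF rect_sets] by (auto simp: E_def)
  also have "\<dots> \<in> sets P"
  proof (intro sets.finite_UN J_fin sets.Int rect_sets)
    fix l assume l: "l \<in> J"
    show "{x \<in> space P. x i \<in> Q l i} \<in> sets P" by (rule component_sets[OF l i])
    have [measurable]: "line_int i (Q l i \<inter> A i) f \<in> borel_measurable P" "line_int i (Q l i \<inter> A i) g \<in> borel_measurable P"
      using i f g C_sets[OF l i] by (auto intro!: line_int_measurable)
    show "{x \<in> space P. line_int i (Q l i \<inter> A i) f x * line_int i (A i) g x < \<eta> * line_int i (Q l i \<inter> A i) g x * line_int i (A i) f x} \<in> sets P"
      by measurable
  qed
  finally show E: "E \<in> sets P" .
  have line_h: "line_int i C h x = \<eta> * (line_int i (A i) f x / line_int i (A i) g x) * line_int i C g x"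
    if "x \<in> rect A" "C \<in> sets (M i)" for x C
    unfolding h_def using i g that sets.sets_into_space[OF rect_sets]
    by (intro line_int_cmult) auto
  have "(\<integral>\<^sup>+x\<in>E. f x \<partial>P) \<le> (\<integral>\<^sup>+x\<in>rect A. h x \<partial>P)"
  proof (rule line_laminar[OF i f h E rect_sets, where \<G> = "(\<lambda>l. Q l i \<inter> A i) ` J"])
    fix x assume x: "x \<in> E"
    then obtain l where xA: "x \<in> rect A" and l: "l \<in> J" and xl: "x i \<in> Q l i"
      and less: "line_int i (Q l i \<inter> A i) f x * line_int i (A i) g x < \<eta> * line_int i (Q l i \<inter> A i) g x * line_int i (A i) f x"
      by (auto simp: E_def)
    define C where "C = Q l i \<inter> A i"
    define p P' where "p = line_int i (A i) f x" and "P' = line_int i (A i) g x"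
    \<comment> \<open>Strictness in \<open>less\<close> excludes a zero right-hand side, so
      \<open>g\<close> has positive integral over \<open>C\<close> and division by \<open>P'\<close>
      is genuine.\<close>
    have "line_int i C g x \<noteq> 0" using less by (auto simp: C_def)
    moreover have "line_int i C g x \<le> P'" unfolding C_def P'_def by (rule line_int_mono_set) auto
    ultimately have P0: "P' \<noteq> 0" "P' < top" using gfin[of x] by (auto simp: P'_def)
    have "line_int i C f x = line_int i C f x * P' / P'"
      using P0 by (intro ennreal_mult_divide_eq[symmetric]) auto
    also have "\<dots> \<le> \<eta> * line_int i C g x * p / P'"
      using less unfolding C_def p_def P'_def by (intro divide_right_mono_ennreal) auto
    also have "\<dots> = \<eta> * line_int i C g x * (p / P')"
      by (simp only: ennreal_times_divide)
    also have "\<dots> = \<eta> * (p / P') * line_int i C g x"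
      by (simp only: mult_ac)
    also have "\<dots> = line_int i C h x"
      using line_h[OF xA] C_sets[OF l i] by (simp add: C_def p_def P'_def)
    finally show "\<exists>C\<in>(\<lambda>l. Q l i \<inter> A i) ` J. x i \<in> C \<and> (\<forall>t\<in>C. x(i := t) \<in> rect A) \<and> line_int i C f x \<le> line_int i C h x"
      using l xl rect_mem[OF xA i] rect_upd[OF xA i] by (auto simp: C_def)
  next
    show "finite ((\<lambda>l. Q l i \<inter> A i) ` J)" using J_fin by simp
    show "(\<lambda>l. Q l i \<inter> A i) ` J \<subseteq> sets (M i)" using C_sets i by auto
    fix C D assume "C \<in> (\<lambda>l. Q l i \<inter> A i) ` J" "D \<in> (\<lambda>l. Q l i \<inter> A i) ` J"
    then show "C \<inter> D = {} \<or> C \<subseteq> D \<or> D \<subseteq> C" using Q_laminar[OF _ _ i] by blast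
  qed
  also have "\<dots> \<le> (\<integral>\<^sup>+x\<in>rect A. \<eta> * f x \<partial>P)"
  proof (rule nn_integral_rect_mono[OF i h])
    fix x assume xA: "x \<in> rect A"
    have xP: "x \<in> space P" using xA sets.sets_into_space[OF rect_sets] by auto
    \<comment> \<open>For \<open>b = 0\<close> and \<open>b = top\<close> the left side is
      \<open>0\<close> in \<open>ennreal\<close>.\<close>
    have *: "a / b * b \<le> a" for a b :: ennreal
    proof (cases "b = 0 \<or> b = top")
      case False
      then have "b / b = 1" by (intro ennreal_divide_self) (auto simp: less_top)
      then show ?thesis unfolding ennreal_divide_times by simp
    qed auto
    have "line_int i (A i) h x = \<eta> * (line_int i (A i) f x / line_int i (A i) g x * line_int i (A i) g x)"
      using line_h[OF xA A_sets[OF i]] by (simp add: mult.assoc)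
    also have "\<dots> \<le> \<eta> * line_int i (A i) f x" by (intro mult_left_mono *) auto
    also have "\<dots> = line_int i (A i) (\<lambda>x. \<eta> * f x) x"
      using line_int_cmult[OF i f xP A_sets[OF i], of "\<lambda>_. \<eta>" \<eta>] by simp
    finally show "line_int i (A i) h x \<le> line_int i (A i) (\<lambda>x. \<eta> * f x) x" .
  qed measurable
  also have "\<dots> = \<eta> * (\<integral>\<^sup>+x\<in>rect A. f x \<partial>P)"
    unfolding mult.assoc by (intro nn_integral_cmult) measurable
  finally show "(\<integral>\<^sup>+x\<in>E. f x \<partial>P) \<le> \<eta> * (\<integral>\<^sup>+x\<in>rect A. f x \<partial>P)" .
qed

text \<open>
  The points covered by some \<open>R\<^sub>l\<close> such that, in none of the directions above \<open>k\<close>, the marginal density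
  grows by more than the factor \<open>c\<close> on passing from \<open>A\<close> to \<open>Q l\<close>.  Integrating out one coordinate
  after the other costs a factor \<open>c\<close> each time and ends with the measure of the covered part.
\<close>

definition low_drop :: "nat set \<Rightarrow> ((nat \<Rightarrow> 'a) \<Rightarrow> ennreal) \<Rightarrow> ennreal \<Rightarrow> nat \<Rightarrow> (nat \<Rightarrow> 'a) set" where
  "low_drop L f c k = {x \<in> rect A. \<exists>l\<in>L. x \<in> rect (Q l) \<and> (\<forall>q\<in>{k<..m}.
     line_int q (Q l q \<inter> A q) (iter_avg A f (q - 1)) x \<le> c * emeasure (M q) (Q l q \<inter> A q) * iter_avg A f q x)}"

lemma rect_Q_sets: "l \<in> J \<Longrightarrow> rect (Q l) \<in> sets P"
  unfolding rect_def using Q_sets by (intro sets_PiM_I_finite) auto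

lemma low_drop_sets:
  assumes L: "L \<subseteq> J" and f: "f \<in> borel_measurable P"
  shows "low_drop L f c k \<in> sets P"
proof -
  have "low_drop L f c k = (\<Union>l\<in>L. rect A \<inter> (rect (Q l) \<inter> {x \<in> space P. \<forall>q\<in>{k<..m}.
     line_int q (Q l q \<inter> A q) (iter_avg A f (q - 1)) x \<le> c * emeasure (M q) (Q l q \<inter> A q) * iter_avg A f q x}))"
    using sets.sets_into_space[OF rect_sets] by (auto simp: low_drop_def)
  also have "\<dots> \<in> sets P"
  proof (intro sets.finite_UN finite_subset[OF L J_fin] sets.Int rect_sets)
    fix l assume "l \<in> L"
    then have l: "l \<in> J" using L by blast
    show "rect (Q l) \<in> sets P" by (rule rect_Q_sets[OF l])
    show "{x \<in> space P. \<forall>q\<in>{k<..m}. line_int q (Q l q \<inter> A q) (iter_avg A f (q - 1)) x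
        \<le> c * emeasure (M q) (Q l q \<inter> A q) * iter_avg A f q x} \<in> sets P"
    proof (intro sets.sets_Collect_finite_All)
      fix q assume q: "q \<in> {k<..m}"
      then have q': "q \<in> {1..m}" by auto
      have [measurable]: "line_int q (Q l q \<inter> A q) (iter_avg A f (q - 1)) \<in> borel_measurable P"
        "iter_avg A f q \<in> borel_measurable P"
        using q q' f C_sets[OF l q'] by (auto intro!: line_int_measurable iter_avg_measurable)
      show "{x \<in> space P. line_int q (Q l q \<inter> A q) (iter_avg A f (q - 1)) x
        \<le> c * emeasure (M q) (Q l q \<inter> A q) * iter_avg A f q x} \<in> sets P" by measurable
    qed auto
  qed
  finally show ?thesis .
qed

text \<open>The condition for \<open>q = Suc k\<close> is the comparison that
  \<open>line_laminar\<close> needs in direction \<open>Suc k\<close>; the conditions for larger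
  \<open>q\<close> define the next set.\<close>

lemma low_drop_step:
  assumes L: "L \<subseteq> J" and f: "f \<in> borel_measurable P" and k: "k < m"
  shows "(\<integral>\<^sup>+x\<in>low_drop L f c k. iter_avg A f k x \<partial>P) \<le> c * (\<integral>\<^sup>+x\<in>low_drop L f c (Suc k). iter_avg A f (Suc k) x \<partial>P)"
proof -
  let ?i = "Suc k"
  have i: "?i \<in> {1..m}" using k by auto
  note [measurable] = low_drop_sets[OF L f]
  have [measurable]: "iter_avg A f k \<in> borel_measurable P" "iter_avg A f ?i \<in> borel_measurable P"
    using k by (auto intro!: iter_avg_measurable[OF f])
  have k1: "iter_avg A f k \<in> borel_measurable P" "(\<lambda>x. c * iter_avg A f ?i x) \<in> borel_measurable P" by measurable
  have "(\<integral>\<^sup>+x\<in>low_drop L f c k. iter_avg A f k x \<partial>P) \<le> (\<integral>\<^sup>+x\<in>low_drop L f c ?i. c * iter_avg A f ?i x \<partial>P)"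
  proof (rule line_laminar[OF i k1, where \<G> = "(\<lambda>l. Q l ?i \<inter> A ?i) ` J"])
    fix x assume "x \<in> low_drop L f c k"
    then obtain l where xA: "x \<in> rect A" and lL: "l \<in> L" and xl: "x \<in> rect (Q l)"
      and le: "\<And>q. q \<in> {k<..m} \<Longrightarrow> line_int q (Q l q \<inter> A q) (iter_avg A f (q - 1)) x
        \<le> c * emeasure (M q) (Q l q \<inter> A q) * iter_avg A f q x"
      by (auto simp: low_drop_def)
    have l: "l \<in> J" using lL L by blast
    define C where "C = Q l ?i \<inter> A ?i"
    have C: "C \<in> sets (M ?i)" using C_sets[OF l i] by (simp add: C_def)
    \<comment> \<open>For \<open>q\<close> above \<open>Suc k\<close> both sides already average
      over coordinate \<open>Suc k\<close>, so the inequalities survive moving \<open>x\<close>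
      along the line.\<close>
    have up: "x(?i := t) \<in> low_drop L f c ?i" if t: "t \<in> C" for t
    proof -
      have "line_int q (Q l q \<inter> A q) (iter_avg A f (q - 1)) (x(?i := t))
          \<le> c * emeasure (M q) (Q l q \<inter> A q) * iter_avg A f q (x(?i := t))" if q: "q \<in> {?i<..m}" for q
      proof -
        have ne: "?i \<noteq> q" and m1: "?i \<in> {1..q - 1}" and m2: "?i \<in> {1..q}" using q by auto
        have "line_int q (Q l q \<inter> A q) (iter_avg A f (q - 1)) (x(?i := t)) = line_int q (Q l q \<inter> A q) (iter_avg A f (q - 1)) x"
          unfolding line_int_def fun_upd_twist[OF ne] iter_avg_upd[OF m1] ..
        then show ?thesis using le[of q] q by (simp add: iter_avg_upd[OF m2])
      qed
      then show ?thesis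
        using lL rect_upd[OF xA i] rect_upd[OF xl i] t unfolding low_drop_def C_def by blast
    qed
    have "line_int ?i C (iter_avg A f k) x \<le> c * iter_avg A f ?i x * emeasure (M ?i) C"
      using le[of ?i] k unfolding C_def by (simp add: mult_ac)
    also have "\<dots> = line_int ?i C (\<lambda>x. c * iter_avg A f ?i x) x"
      using C by (intro line_int_invariant[symmetric]) (auto simp: iter_avg_upd i)
    finally show "\<exists>C\<in>(\<lambda>l. Q l ?i \<inter> A ?i) ` J. x ?i \<in> C \<and> (\<forall>t\<in>C. x(?i := t) \<in> low_drop L f c ?i) \<and>
        line_int ?i C (iter_avg A f k) x \<le> line_int ?i C (\<lambda>x. c * iter_avg A f ?i x) x"
      using l up rect_mem[OF xA i] rect_mem[OF xl i] unfolding C_def by blast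
  next
    show "finite ((\<lambda>l. Q l ?i \<inter> A ?i) ` J)" using J_fin by simp
    show "(\<lambda>l. Q l ?i \<inter> A ?i) ` J \<subseteq> sets (M ?i)" using C_sets i by auto
    fix C D assume "C \<in> (\<lambda>l. Q l ?i \<inter> A ?i) ` J" "D \<in> (\<lambda>l. Q l ?i \<inter> A ?i) ` J"
    then show "C \<inter> D = {} \<or> C \<subseteq> D \<or> D \<subseteq> C" using Q_laminar[OF _ _ i] by blast
  qed (use low_drop_sets[OF L f] in auto)
  also have "\<dots> = c * (\<integral>\<^sup>+x\<in>low_drop L f c ?i. iter_avg A f ?i x \<partial>P)"
    unfolding mult.assoc by (intro nn_integral_cmult) measurable
  finally show ?thesis .
qed

text \<open>The \<open>m\<close> elimination steps cost \<open>c ^ m\<close>. What remains is the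
  constant mean of \<open>f\<close> on the covered part \<open>U\<close>, which is at most the
  fraction \<open>\<delta>\<close> of the rectangle.\<close>

lemma low_drop_mass:
  assumes L: "L \<subseteq> J" and f: "f \<in> borel_measurable P"
    and \<delta>: "emeasure P (rect A \<inter> (\<Union>l\<in>L. rect (Q l))) \<le> \<delta> * emeasure P (rect A)"
  shows "(\<integral>\<^sup>+x\<in>low_drop L f c 0. f x \<partial>P) \<le> c ^ m * \<delta> * (\<integral>\<^sup>+x\<in>rect A. f x \<partial>P)"
proof -
  have "(\<integral>\<^sup>+x\<in>low_drop L f c 0. f x \<partial>P) \<le> c ^ k * (\<integral>\<^sup>+x\<in>low_drop L f c k. iter_avg A f k x \<partial>P)" if "k \<le> m" for k
    using that
  proof (induction k)
    case (Suc k)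
    then have "(\<integral>\<^sup>+x\<in>low_drop L f c 0. f x \<partial>P) \<le> c ^ k * (\<integral>\<^sup>+x\<in>low_drop L f c k. iter_avg A f k x \<partial>P)" by simp
    also have "\<dots> \<le> c ^ k * (c * (\<integral>\<^sup>+x\<in>low_drop L f c (Suc k). iter_avg A f (Suc k) x \<partial>P))"
      using low_drop_step[OF L f, of k c] Suc.prems by (intro mult_left_mono) auto
    finally show ?case by (simp only: power_Suc mult_ac)
  qed simp
  from this[of m] have *: "(\<integral>\<^sup>+x\<in>low_drop L f c 0. f x \<partial>P) \<le> c ^ m * (\<integral>\<^sup>+x\<in>low_drop L f c m. iter_avg A f m x \<partial>P)" by simp
  define U where "U = rect A \<inter> (\<Union>l\<in>L. rect (Q l))"
  have U: "low_drop L f c m = U" by (auto simp: low_drop_def U_def)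
  have "(\<integral>\<^sup>+x\<in>U. iter_avg A f m x \<partial>P) \<le> \<delta> * (\<integral>\<^sup>+x\<in>rect A. f x \<partial>P)"
  proof -
    have "rect A \<noteq> {}" using emeasure_rect_pos by auto
    then obtain x0 where x0: "x0 \<in> rect A" by blast
    have "(\<integral>\<^sup>+x\<in>U. iter_avg A f m x \<partial>P) = (\<integral>\<^sup>+x\<in>U. iter_avg A f m x0 \<partial>P)"
    proof (rule nn_integral_cong)
      fix y show "iter_avg A f m y * indicator U y = iter_avg A f m x0 * indicator U y"
      proof (cases "y \<in> U")
        case True
        then have "iter_avg A f m y = iter_avg A f m x0"
          using x0 by (intro iter_avg_const) (auto simp: rect_def PiE_iff U_def)
        then show ?thesis by (simp only:)
      qed simp
    qed
    also have "\<dots> = iter_avg A f m x0 * emeasure P U"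
      using low_drop_sets[OF L f, of c m] unfolding U by (rule nn_integral_cmult_indicator)
    also have "\<dots> \<le> iter_avg A f m x0 * (\<delta> * emeasure P (rect A))"
      using \<delta> unfolding U_def by (intro mult_left_mono) auto
    also have "\<dots> = \<delta> * (iter_avg A f m x0 * emeasure P (rect A))" by (simp only: mult_ac)
    also have "\<dots> = \<delta> * (\<integral>\<^sup>+x\<in>rect A. f x \<partial>P)" by (simp only: iter_avg_full[OF f x0])
    finally show ?thesis .
  qed
  then have "c ^ m * (\<integral>\<^sup>+x\<in>low_drop L f c m. iter_avg A f m x \<partial>P) \<le> c ^ m * (\<delta> * (\<integral>\<^sup>+x\<in>rect A. f x \<partial>P))"
    unfolding U by (intro mult_left_mono) auto
  from order_trans[OF * this] show ?thesis by (simp only: mult.assoc)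
qed

text \<open>The complement of the exceptional sets, with quotients multiplied out to avoid division
  in \<open>ennreal\<close>. Side measures appear as line integrals of 1 because that condition
  comes from \<open>transfer_mass\<close> with \<open>g = 1\<close>; the last one comes from its
  instance with the marginal density.\<close>

definition typical :: "nat set \<Rightarrow> ((nat \<Rightarrow> 'a) \<Rightarrow> ennreal) \<Rightarrow> ennreal \<Rightarrow> ennreal \<Rightarrow> (nat \<Rightarrow> 'a) set" where
  "typical L f \<eta> c = {x \<in> rect A. x \<notin> low_drop L f c 0 \<and> (\<forall>i\<in>{1..m}.
     \<eta> * emeasure (M i) (A i) \<le> line_int i (A i) f x \<and>
     \<eta> * line_int i (A i) f x \<le> f x * emeasure (M i) (A i) \<and>
     (\<forall>l\<in>J. x i \<in> Q l i \<longrightarrow>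
        \<eta> * line_int i (Q l i \<inter> A i) (\<lambda>_. 1) x * line_int i (A i) f x
          \<le> line_int i (Q l i \<inter> A i) f x * line_int i (A i) (\<lambda>_. 1) x \<and>
        \<eta> * line_int i (Q l i \<inter> A i) (iter_avg A f (i - 1)) x * line_int i (A i) f x
          \<le> line_int i (Q l i \<inter> A i) f x * line_int i (A i) (iter_avg A f (i - 1)) x))}"

lemma line_int_one: "B \<in> sets (M i) \<Longrightarrow> line_int i B (\<lambda>_. 1) x = emeasure (M i) B"
  by (simp add: line_int_invariant[where c = 1])

lemma line_int_finite:
  assumes "\<And>x. f x \<le> K" "K < \<infinity>" "i \<in> {1..m}"
  shows "line_int i (A i) f x < \<infinity>"
proof -
  have "line_int i (A i) f x \<le> K * emeasure (M i) (A i)"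
    using assms A_sets by (intro line_int_le_cmult) auto
  also have "\<dots> < \<infinity>" using assms(2) A_fin[OF assms(3)] by (simp add: ennreal_mult_less_top)
  finally show ?thesis .
qed

text \<open>Each direction loses \<open>\<eta>\<close> once relative to the measure (low line
  averages) and three times relative to the mass (low values and two transfers);
  \<open>low_drop_mass\<close> adds \<open>c ^ m * \<delta>\<close>.\<close>

lemma typical_mass:
  assumes L: "L \<subseteq> J" and f: "f \<in> borel_measurable P" and K: "\<And>x. f x \<le> K" "K < \<infinity>"
    and \<delta>: "emeasure P (rect A \<inter> (\<Union>l\<in>L. rect (Q l))) \<le> \<delta> * emeasure P (rect A)"
  shows "typical L f \<eta> c \<in> sets P" (is "?T \<in> _")
    and "(\<integral>\<^sup>+x\<in>rect A. f x \<partial>P) \<le> (\<integral>\<^sup>+x\<in>typical L f \<eta> c. f x \<partial>P) + of_nat m * \<eta> * emeasure P (rect A)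
      + (of_nat (3 * m) * \<eta> + c ^ m * \<delta>) * (\<integral>\<^sup>+x\<in>rect A. f x \<partial>P)"
proof -
  define E1 where "E1 i = {x \<in> rect A. line_int i (A i) f x < \<eta> * emeasure (M i) (A i)}" for i
  define E2 where "E2 i = {x \<in> rect A. f x * emeasure (M i) (A i) < \<eta> * line_int i (A i) f x}" for i
  define E where "E g i = {x \<in> rect A. \<exists>l\<in>J. x i \<in> Q l i \<and>
    line_int i (Q l i \<inter> A i) f x * line_int i (A i) g x < \<eta> * line_int i (Q l i \<inter> A i) g x * line_int i (A i) f x}" for g i
  define B where "B i = E1 i \<union> E2 i \<union> E (\<lambda>_. 1) i \<union> E (iter_avg A f (i - 1)) i" for i
  let ?I = "\<integral>\<^sup>+x\<in>rect A. f x \<partial>P"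
  have g: "iter_avg A f (i - 1) \<in> borel_measurable P" if "i \<in> {1..m}" for i
    using that by (intro iter_avg_measurable[OF f]) auto
  have gK: "line_int i (A i) (iter_avg A f (i - 1)) x < \<infinity>" if "i \<in> {1..m}" for i x
    using that by (intro line_int_finite[OF iter_avg_le[OF K(1)] K(2)]) auto
  have oneK: "line_int i (A i) (\<lambda>_. 1) x < \<infinity>" if "i \<in> {1..m}" for i x
    using that by (intro line_int_finite[of _ 1]) auto
  have sets: "E1 i \<in> sets P" "E2 i \<in> sets P" "E (\<lambda>_. 1) i \<in> sets P" "E (iter_avg A f (i - 1)) i \<in> sets P" if "i \<in> {1..m}" for i
    using low_line_mass(1)[OF that f] low_point_mass(1)[OF that f] transfer_mass(1)[OF that f _ oneK[OF that]]
      transfer_mass(1)[OF that f g[OF that] gK[OF that]]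
    unfolding E1_def E2_def E_def by auto
  have Bsets: "B i \<in> sets P" if "i \<in> {1..m}" for i using sets[OF that] unfolding B_def by auto
  have B: "(\<integral>\<^sup>+x\<in>B i. f x \<partial>P) \<le> \<eta> * emeasure P (rect A) + \<eta> * ?I + \<eta> * ?I + \<eta> * ?I" if i: "i \<in> {1..m}" for i
  proof -
    have "(\<integral>\<^sup>+x\<in>B i. f x \<partial>P) \<le> (\<integral>\<^sup>+x\<in>E1 i. f x \<partial>P) + (\<integral>\<^sup>+x\<in>E2 i. f x \<partial>P) + (\<integral>\<^sup>+x\<in>E (\<lambda>_. 1) i. f x \<partial>P)
        + (\<integral>\<^sup>+x\<in>E (iter_avg A f (i - 1)) i. f x \<partial>P)"
      unfolding B_def using sets[OF i] by (auto intro!: order_trans[OF nn_integral_Un_le[OF f]] add_mono)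
    also have "\<dots> \<le> \<eta> * emeasure P (rect A) + \<eta> * ?I + \<eta> * ?I + \<eta> * ?I"
      using low_line_mass(2)[OF i f] low_point_mass(2)[OF i f] transfer_mass(2)[OF i f _ oneK[OF i]]
        transfer_mass(2)[OF i f g[OF i] gK[OF i]]
      unfolding E1_def E2_def E_def by (intro add_mono) auto
    finally show ?thesis .
  qed
  have T_eq: "?T = rect A - (low_drop L f c 0 \<union> (\<Union>i\<in>{1..m}. B i))"
    unfolding typical_def B_def E1_def E2_def E_def not_less[symmetric] by blast
  have BU: "(\<Union>i\<in>{1..m}. B i) \<in> sets P" using Bsets by auto
  note ld = low_drop_sets[OF L f, of c 0]
  show T: "?T \<in> sets P" unfolding T_eq using ld BU rect_sets by blast
  have "?I \<le> (\<integral>\<^sup>+x\<in>?T \<union> ((\<Union>i\<in>{1..m}. B i) \<union> low_drop L f c 0). f x \<partial>P)"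
    unfolding T_eq by (intro nn_integral_mono) (auto simp: indicator_def)
  also have "\<dots> \<le> (\<integral>\<^sup>+x\<in>?T. f x \<partial>P) + ((\<integral>\<^sup>+x\<in>(\<Union>i\<in>{1..m}. B i). f x \<partial>P) + (\<integral>\<^sup>+x\<in>low_drop L f c 0. f x \<partial>P))"
    using T BU ld by (auto intro!: order_trans[OF nn_integral_Un_le[OF f]] add_mono)
  also have "\<dots> \<le> (\<integral>\<^sup>+x\<in>?T. f x \<partial>P) + ((\<Sum>i\<in>{1..m}. \<eta> * emeasure P (rect A) + \<eta> * ?I + \<eta> * ?I + \<eta> * ?I) + c ^ m * \<delta> * ?I)"
    using B low_drop_mass[OF L f \<delta>] Bsets
    by (intro add_mono order_refl order_trans[OF nn_integral_UN_le[OF f]] sum_mono) auto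
  also have "\<dots> = (\<integral>\<^sup>+x\<in>?T. f x \<partial>P) + of_nat m * \<eta> * emeasure P (rect A) + (of_nat (3 * m) * \<eta> + c ^ m * \<delta>) * ?I"
  proof -
    have "3 * m = m + m + m" by simp
    then have three: "of_nat (3 * m) = (of_nat m + of_nat m + of_nat m :: ennreal)"
      by (simp only: of_nat_add)
    show ?thesis unfolding three by (simp add: algebra_simps)
  qed
  finally show "?I \<le> (\<integral>\<^sup>+x\<in>?T. f x \<partial>P) + of_nat m * \<eta> * emeasure P (rect A) + (of_nat (3 * m) * \<eta> + c ^ m * \<delta>) * ?I" .
qed

text \<open>This is the transfer condition with \<open>g = 1\<close> for a side inside
  \<open>A i\<close>: shrinking the side keeps at least the fraction \<open>\<eta>\<close> of the
  line average.\<close>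

lemma typical_subset:
  assumes "x \<in> typical L f \<eta> c" "l \<in> J" "i \<in> {1..m}" "x i \<in> Q l i" "Q l i \<subseteq> A i"
  shows "\<eta> * emeasure (M i) (Q l i) * line_int i (A i) f x \<le> line_int i (Q l i) f x * emeasure (M i) (A i)"
proof -
  have "Q l i \<inter> A i = Q l i" using assms(5) by blast
  moreover have "\<eta> * line_int i (Q l i \<inter> A i) (\<lambda>_. 1) x * line_int i (A i) f x
      \<le> line_int i (Q l i \<inter> A i) f x * line_int i (A i) (\<lambda>_. 1) x"
    using assms(1-4) unfolding typical_def by blast
  ultimately show ?thesis using assms Q_sets A_sets by (simp add: line_int_one)
qed

text \<open>
  The growth of the marginals excluded in \<^const>\<open>low_drop\<close> is transferred back to \<open>f\<close> itself.
\<close>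

lemma typical_drop:
  assumes x: "x \<in> typical L f \<eta> c" and L: "L \<subseteq> J" and l: "l \<in> L" and xl: "x \<in> rect (Q l)"
    and K: "\<And>x. f x \<le> K" "K < \<infinity>" and \<eta>: "0 < \<eta>" "\<eta> < \<infinity>"
  shows "\<exists>q\<in>{1..m}. c * \<eta> * emeasure (M q) (Q l q \<inter> A q) * line_int q (A q) f x
    < line_int q (Q l q \<inter> A q) f x * emeasure (M q) (A q)"
proof (rule ccontr)
  assume neg: "\<not> ?thesis"
  have xA: "x \<in> rect A" using x by (simp add: typical_def)
  have "line_int q (Q l q \<inter> A q) (iter_avg A f (q - 1)) x \<le> c * emeasure (M q) (Q l q \<inter> A q) * iter_avg A f q x"
    if "q \<in> {0<..m}" for q
  proof -
    have q: "q \<in> {1..m}" using that by auto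
    define p a C where "p = line_int q (A q) f x" and "a = emeasure (M q) (A q)" and "C = Q l q \<inter> A q"
    define G p' where "G = iter_avg A f (q - 1)" and "p' = line_int q (A q) G x"
    have le: "line_int q C f x * a \<le> c * \<eta> * emeasure (M q) C * p"
      using neg q unfolding p_def a_def C_def by (meson not_less)
    have "\<forall>l\<in>J. x q \<in> Q l q \<longrightarrow> \<eta> * line_int q (Q l q \<inter> A q) G x * line_int q (A q) f x
          \<le> line_int q (Q l q \<inter> A q) f x * line_int q (A q) G x" and lo: "\<eta> * a \<le> p"
      using x q unfolding typical_def G_def a_def p_def by blast+
    then have tr: "\<eta> * line_int q C G x * p \<le> line_int q C f x * p'"
      using l L rect_mem[OF xl q] unfolding C_def p_def p'_def by blast
    have a0: "0 < a" "a < top" using A_pos[OF q] A_fin[OF q] by (auto simp: a_def)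
    \<comment> \<open>The lower bound on line averages makes \<open>p\<close> positive and
      boundedness of \<open>f\<close> makes it finite, so \<open>\<eta> * p\<close> can be cancelled
      below.\<close>
    have "0 < \<eta> * a" using a0 \<eta> by (simp add: ennreal_zero_less_mult_iff)
    from this lo have p0: "0 < p" by (rule less_le_trans)
    have ptop: "p < top" using line_int_finite[OF K q] unfolding p_def by simp
    have "(\<eta> * p) * (line_int q C G x * a) = (\<eta> * line_int q C G x * p) * a" by (simp only: mult_ac)
    also have "\<dots> \<le> (line_int q C f x * p') * a" using tr by (rule mult_right_mono) simp
    also have "\<dots> = (line_int q C f x * a) * p'" by (simp only: mult_ac)
    also have "\<dots> \<le> (c * \<eta> * emeasure (M q) C * p) * p'" using le by (rule mult_right_mono) simp
    also have "\<dots> = (\<eta> * p) * (c * emeasure (M q) C * p')" by (simp only: mult_ac)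
    finally have "line_int q C G x * a \<le> c * emeasure (M q) C * p'"
      using p0 ptop \<eta> by (subst (asm) ennreal_mult_le_mult_iff) (auto simp: ennreal_mult_eq_top_iff ennreal_mult_less_top)
    then have "line_int q C G x \<le> c * emeasure (M q) C * p' / a"
      unfolding a_def le_divide_A[OF q] .
    moreover have "iter_avg A f q x = p' / a"
    proof -
      have "q = Suc (q - 1)" using q by auto
      then show ?thesis unfolding p'_def a_def G_def using iter_avg.simps(2)[of A f "q - 1"] by simp
    qed
    ultimately show ?thesis unfolding C_def G_def by (simp add: ennreal_times_divide)
  qed
  then have "x \<in> low_drop L f c 0" using xA l xl unfolding low_drop_def by blast
  then show False using x by (simp add: typical_def)
qed

end

subsection \<open>Sparse families\<close>

text \<open>
  If two elements had rounded logarithms differing by a multiple of \<open>(1, \<dots>, 1)\<close>, then \<open>up\<close> would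
  bound the multiple by 1 and \<open>down\<close> would make it at least 2.
\<close>

lemma card_log_antichain:
  fixes a :: "nat \<Rightarrow> nat \<Rightarrow> real"
  assumes fin: "finite S" and n: "n \<ge> 1" and b: "b \<ge> exp 1" and F: "F \<ge> 0"
    and lo: "\<And>j i. j \<in> S \<Longrightarrow> i \<in> {1..n} \<Longrightarrow> 1 / b \<le> a j i"
    and hi: "\<And>j i. j \<in> S \<Longrightarrow> i \<in> {1..n} \<Longrightarrow> a j i \<le> b * F"
    and up: "\<And>l j. l \<in> S \<Longrightarrow> j \<in> S \<Longrightarrow> l < j \<Longrightarrow> \<exists>i\<in>{1..n}. a l i \<le> b * a j i"
    and down: "\<And>l j. l \<in> S \<Longrightarrow> j \<in> S \<Longrightarrow> l < j \<Longrightarrow> \<exists>i\<in>{1..n}. b\<^sup>2 * a j i < a l i"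
  shows "real (card S) \<le> (7 * ln (exp 1 + F)) ^ (n - 1)"
proof (cases "S = {}")
  case True
  have "ln (exp 1 + F) \<ge> 0" using F by (intro ln_ge_zero) (use exp_ge_add_one_self[of 1] in linarith)
  then show ?thesis using True by simp
next
  case False
  then obtain j0 where j0: "j0 \<in> S" by blast
  have b1: "b > 1" using b exp_ge_add_one_self[of 1] by linarith
  have n1: "1 \<in> {1..n}" using n by auto
  have "1 / b \<le> b * F" using lo[OF j0 n1] hi[OF j0 n1] by linarith
  then have Fb: "1 / b\<^sup>2 \<le> F" using b1 by (simp add: field_simps power2_eq_square)
  moreover have "0 < 1 / b\<^sup>2" using b1 by simp
  ultimately have F0: "F > 0" by linarith
  define L where "L = log b F"
  \<comment> \<open>The bounds \<open>1 / b\<close> and \<open>b * F\<close> are compatible only for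
    such \<open>L\<close>; this keeps \<open>w\<close> nonnegative.\<close>
  have L2: "L \<ge> -2"
  proof -
    have "log b (1 / b\<^sup>2) \<le> log b F" using b1 Fb F0 by (intro log_mono) auto
    moreover have "log b (1 / b\<^sup>2) = -2" using b1 by (simp add: log_divide log_nat_power)
    ultimately show ?thesis by (simp add: L_def)
  qed
  define k where "k j i = \<lfloor>log b (a j i)\<rfloor>" for j i
  have apos: "a j i > 0" if "j \<in> S" "i \<in> {1..n}" for j i
  proof -
    have "0 < 1 / b" using b1 by simp
    then show ?thesis using lo[OF that] by linarith
  qed
  have klo: "- 1 \<le> k j i" if "j \<in> S" "i \<in> {1..n}" for j i
  proof -
    have "log b (1 / b) \<le> log b (a j i)" using b1 lo[OF that] apos[OF that] by (simp add: log_le_cancel_iff)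
    moreover have "log b (1 / b) = - 1" using b1 by (simp add: log_divide)
    ultimately show ?thesis by (simp add: k_def le_floor_iff)
  qed
  have khi: "k j i \<le> \<lfloor>L\<rfloor> + 1" if "j \<in> S" "i \<in> {1..n}" for j i
  proof -
    have "log b (a j i) \<le> log b (b * F)" using b1 hi[OF that] apos[OF that] F0 by (simp add: log_le_cancel_iff)
    also have "\<dots> = L + 1" using b1 F0 by (simp add: log_mult L_def)
    finally show ?thesis unfolding k_def by linarith
  qed
  \<comment> \<open>The rounded logarithms lie between -1 and
    \<open>\<lfloor>L\<rfloor> + 1\<close>, so two of them differ by at most
    \<open>w\<close>.\<close>
  define w where "w = \<lfloor>L\<rfloor> + 2"
  have w0: "w \<ge> 0" using L2 unfolding w_def by linarith
  \<comment> \<open>Subtracting the first entry passes to the quotient by the diagonal and leaves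
    \<open>n - 1\<close> integers.\<close>
  define g where "g j = (\<lambda>i\<in>{2..n}. k j i - k j 1)" for j
  have "inj_on g S"
  proof (rule linorder_inj_onI')
    fix l j assume l: "l \<in> S" and j: "j \<in> S" and lj: "l < j"
    show "g l \<noteq> g j"
    proof
      assume eq: "g l = g j"
      have const: "k l i - k j i = k l 1 - k j 1" if "i \<in> {1..n}" for i
      proof (cases "i = 1")
        case False
        then have "i \<in> {2..n}" using that by auto
        then have "k l i - k l 1 = k j i - k j 1" using fun_cong[OF eq, of i] by (simp add: g_def)
        then show ?thesis by linarith
      qed simp
      obtain s where s: "s \<in> {1..n}" "a l s \<le> b * a j s" using up[OF l j lj] by blast
      obtain t where t: "t \<in> {1..n}" "b\<^sup>2 * a j t < a l t" using down[OF l j lj] by blast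
      have "log b (a l s) \<le> log b (b * a j s)"
        using b1 s apos[OF l s(1)] apos[OF j s(1)] by (simp add: log_le_cancel_iff)
      also have "\<dots> = log b (a j s) + 1" using b1 apos[OF j s(1)] by (simp add: log_mult)
      finally have "k l s \<le> k j s + 1" unfolding k_def by linarith
      moreover have "log b (b\<^sup>2 * a j t) < log b (a l t)"
        using b1 t apos[OF l t(1)] apos[OF j t(1)] by (simp add: log_less_cancel_iff)
      then have "log b (a j t) + 2 < log b (a l t)"
        using b1 apos[OF j t(1)] by (simp add: log_mult log_nat_power)
      then have "k j t + 2 \<le> k l t" unfolding k_def by linarith
      ultimately show False using const[OF s(1)] const[OF t(1)] by linarith
    qed
  qed
  moreover have "g ` S \<subseteq> ({2..n} \<rightarrow>\<^sub>E {- w..w})"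
  proof
    fix y assume "y \<in> g ` S"
    then obtain j where j: "j \<in> S" and y: "y = g j" by blast
    have "k j i - k j 1 \<in> {- w..w}" if "i \<in> {2..n}" for i
    proof -
      have i: "i \<in> {1..n}" using that by auto
      show ?thesis using klo[OF j i] khi[OF j i] klo[OF j n1] khi[OF j n1] by (auto simp: w_def)
    qed
    then show "y \<in> ({2..n} \<rightarrow>\<^sub>E {- w..w})" by (auto simp: y g_def)
  qed
  ultimately have "card S \<le> card ({2..n} \<rightarrow>\<^sub>E {- w..w})"
    by (intro card_inj_on_le[of g]) (auto intro: finite_PiE)
  also have "\<dots> = nat (2 * w + 1) ^ (n - 1)"
    using n by (simp add: card_PiE)
  finally have "real (card S) \<le> real (nat (2 * w + 1) ^ (n - 1))" by simp
  also have "\<dots> = (2 * real_of_int w + 1) ^ (n - 1)" using w0 by simp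
  also have "\<dots> \<le> (7 * ln (exp 1 + F)) ^ (n - 1)"
  proof (rule power_mono)
    \<comment> \<open>Since \<open>w\<close> is at most \<open>L + 2\<close>,
      \<open>2 * w + 1\<close> is at most \<open>2 * L + 5\<close>; both \<open>L\<close> and 1 are
      bounded by the logarithm, whence the factor 7.\<close>
    have l1: "1 \<le> ln (exp 1 + F)"
      using F0 by (subst ln_ge_iff) (auto intro: add_pos_pos)
    have "L \<le> ln (exp 1 + F)"
    proof (cases "F \<ge> 1")
      case True
      have "ln b \<ge> 1" using b b1 by (simp add: ln_ge_iff)
      moreover have "ln F \<ge> 0" using True by simp
      ultimately have "L \<le> ln F" unfolding L_def log_def
        by (metis div_by_1 frac_le order_refl zero_less_one)
      also have "\<dots> \<le> ln (exp 1 + F)" using F0 by (subst ln_le_cancel_iff) (auto intro: add_pos_pos)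
      finally show ?thesis .
    next
      case False
      then have "L \<le> 0" using b1 F0 by (simp add: L_def)
      then show ?thesis using l1 by linarith
    qed
    then show "2 * real_of_int w + 1 \<le> 7 * ln (exp 1 + F)"
      using l1 unfolding w_def by (simp; linarith)
  qed (use w0 in simp)
  finally show ?thesis .
qed

section \<open>Counting the rectangles in which a point is typical\<close>

context finite_product begin

text \<open>The measure of each rectangle is at most twice the mass of its typical points. In the
  sum over \<open>j\<close> a point is counted once for every rectangle in which it is typical, and
  \<open>card_log_antichain\<close> bounds that number.\<close>

lemma sparse_family_sum:
  fixes f :: "(nat \<Rightarrow> 'a) \<Rightarrow> real" and Q :: "nat \<Rightarrow> nat \<Rightarrow> 'a set"
  assumes m: "m \<ge> 2" and fin: "finite J"
    and sets: "\<And>j i. j \<in> J \<Longrightarrow> i \<in> {1..m} \<Longrightarrow> Q j i \<in> sets (M i)"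
    and pos: "\<And>j i. j \<in> J \<Longrightarrow> i \<in> {1..m} \<Longrightarrow> 0 < emeasure (M i) (Q j i)"
    and finite: "\<And>j i. j \<in> J \<Longrightarrow> i \<in> {1..m} \<Longrightarrow> emeasure (M i) (Q j i) < \<infinity>"
    and laminar: "\<And>l j i. l \<in> J \<Longrightarrow> j \<in> J \<Longrightarrow> i \<in> {1..m} \<Longrightarrow>
      Q l i \<inter> Q j i = {} \<or> Q l i \<subseteq> Q j i \<or> Q j i \<subseteq> Q l i"
    and mono: "\<And>l j. l \<in> J \<Longrightarrow> j \<in> J \<Longrightarrow> l < j \<Longrightarrow> rect (Q l) \<inter> rect (Q j) \<noteq> {} \<Longrightarrow>
      Q j m \<subseteq> Q l m \<and> (\<exists>i\<in>{1..m - 1}. Q j i \<subseteq> Q l i)"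
    and sparse: "\<And>j. j \<in> J \<Longrightarrow> emeasure P (rect (Q j) \<inter> (\<Union>l\<in>{l \<in> J. l < j}. rect (Q l)))
      \<le> ennreal ((1 / (28 * real m)) ^ (3 * m) / 8) * emeasure P (rect (Q j))"
    and f: "f \<in> borel_measurable P" and f0: "\<And>x. 0 \<le> f x" and fK: "\<And>x. f x \<le> K"
    and avg: "\<And>j. j \<in> J \<Longrightarrow> emeasure P (rect (Q j)) \<le> (\<integral>\<^sup>+x\<in>rect (Q j). ennreal (f x) \<partial>P)"
      "\<And>j. j \<in> J \<Longrightarrow> (\<integral>\<^sup>+x\<in>rect (Q j). ennreal (f x) \<partial>P) \<le> 2 * emeasure P (rect (Q j))"
  shows "(\<Sum>j\<in>J. emeasure P (rect (Q j))) \<le> 2 * (\<integral>\<^sup>+x. ennreal (f x * (7 * ln (exp 1 + f x)) ^ (m - 2)) \<partial>P)"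
proof -
  define F where "F x = ennreal (f x)" for x
  have F: "F \<in> borel_measurable P" unfolding F_def using f by measurable
  have FK: "F x \<le> ennreal K" for x unfolding F_def using fK by (rule ennreal_leI)
  have Ktop: "ennreal K < \<infinity>" by simp
  \<comment> \<open>With \<open>\<eta> = 1 / b\<close> the losses in \<open>typical_mass\<close> are
    1/28 of the measure and 3/28 of the mass. Taking \<open>c = b ^ 3\<close> leaves
    \<open>c * \<eta> = b\<^sup>2\<close>, the gap required by \<open>card_log_antichain\<close>,
    and makes \<open>c ^ m\<close> times the sparseness ratio equal to 1/8.\<close>
  define b where "b = 28 * real m"
  have b56: "b \<ge> 56" using m by (simp add: b_def)
  have bpos: "b > 0" using b56 by simp
  define \<eta> where "\<eta> = ennreal (1 / b)"
  have \<eta>: "0 < \<eta>" "\<eta> < \<infinity>" using bpos by (auto simp: \<eta>_def)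
  define c where "c = ennreal (b ^ 3)"
  define L where "L j = {l \<in> J. l < j}" for j
  define T where "T j = rect_in_family.typical M m (Q j) J Q (L j) F \<eta> c" for j
  have fam: "rect_in_family M m (Q j) J Q" if "j \<in> J" for j
    using that sets pos finite laminar fin by unfold_locales auto
  have LJ: "L j \<subseteq> J" for j by (auto simp: L_def)
  have T_sets: "T j \<in> sets P" and T_mass: "emeasure P (rect (Q j)) \<le> 2 * (\<integral>\<^sup>+x\<in>T j. F x \<partial>P)" if j: "j \<in> J" for j
  proof -
    interpret R: rect_in_family M m "Q j" J Q by (rule fam[OF j])
    define R I T' where "R = emeasure P (rect (Q j))" and "I = (\<integral>\<^sup>+x\<in>rect (Q j). F x \<partial>P)" and "T' = (\<integral>\<^sup>+x\<in>T j. F x \<partial>P)"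
    have \<delta>: "emeasure P (rect (Q j) \<inter> (\<Union>l\<in>L j. rect (Q l))) \<le> ennreal ((1 / b) ^ (3 * m) / 8) * emeasure P (rect (Q j))"
      using sparse[OF j] by (simp only: L_def b_def)
    note tm = R.typical_mass[OF LJ F FK Ktop \<delta>, of \<eta> c]
    show "T j \<in> sets P" using tm(1) by (simp only: T_def)
    have cm: "c ^ m * ennreal ((1 / b) ^ (3 * m) / 8) = ennreal (1 / 8)"
    proof -
      have "(b ^ 3) ^ m * ((1 / b) ^ (3 * m) / 8) = 1 / 8"
        using bpos by (simp add: power_mult[symmetric] power_divide)
      then show ?thesis unfolding c_def using bpos by (simp add: ennreal_power ennreal_mult[symmetric])
    qed
    have m1: "of_nat m * \<eta> = ennreal (1 / 28)" "of_nat (3 * m) * \<eta> = ennreal (3 / 28)"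
      using m bpos unfolding \<eta>_def b_def ennreal_of_nat_eq_real_of_nat
      by (subst ennreal_mult[symmetric]; simp)+
    have IR: "R \<le> I" "I \<le> 2 * R" using avg[OF j] by (simp_all only: F_def R_def I_def)
    have Rfin: "R < top" using R.emeasure_rect_finite by (simp add: R_def)
    have main: "I \<le> T' + ennreal (1 / 28) * R + (ennreal (3 / 28) + ennreal (1 / 8)) * I"
      using tm(2) unfolding cm m1 by (simp only: T_def R_def I_def T'_def)
    show "emeasure P (rect (Q j)) \<le> 2 * (\<integral>\<^sup>+x\<in>T j. F x \<partial>P)"
    proof (cases "T' = top")
      case True
      then have "2 * (\<integral>\<^sup>+x\<in>T j. F x \<partial>P) = top" by (simp add: T'_def[symmetric] ennreal_mult_top)
      then show ?thesis by simp
    next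
      case False
      then obtain t where t: "T' = ennreal t" "t \<ge> 0" by (cases T') auto
      obtain r where r: "R = ennreal r" "r \<ge> 0" using Rfin by (cases R) auto
      have "I < top" using IR(2) Rfin by (metis ennreal_mult_less_top ennreal_numeral_less_top le_less_trans)
      then obtain s where s: "I = ennreal s" "s \<ge> 0" by (cases I) auto
      have sr: "r \<le> s" "s \<le> 2 * r"
        using IR r s by (auto simp: ennreal_mult[symmetric] ennreal_numeral[symmetric] simp del: ennreal_numeral)
      have "ennreal s \<le> ennreal (t + 1 / 28 * r + (3 / 28 + 1 / 8) * s)"
      proof -
        have "ennreal (1 / 28) * ennreal r = ennreal (1 / 28 * r)"
          using r(2) by (intro ennreal_mult[symmetric]) auto
        moreover have "ennreal (3 / 28) + ennreal (1 / 8) = ennreal (3 / 28 + 1 / 8)"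
          by (intro ennreal_plus[symmetric]) auto
        moreover have "ennreal (3 / 28 + 1 / 8) * ennreal s = ennreal ((3 / 28 + 1 / 8) * s)"
          using s(2) by (intro ennreal_mult[symmetric]) auto
        ultimately have "ennreal s \<le> ennreal t + ennreal (1 / 28 * r) + ennreal ((3 / 28 + 1 / 8) * s)"
          using main unfolding t(1) r(1) s(1) by (simp only:)
        also have "\<dots> = ennreal (t + 1 / 28 * r + (3 / 28 + 1 / 8) * s)"
          using t(2) r(2) s(2) by (subst ennreal_plus[symmetric]; (subst ennreal_plus[symmetric])?; simp)
        finally show ?thesis .
      qed
      then have "s \<le> t + 1 / 28 * r + (3 / 28 + 1 / 8) * s" using t r s by (subst (asm) ennreal_le_iff) auto
      \<comment> \<open>As \<open>r \<le> s\<close>, the losses total at most 1/28 + 3/28 + 1/8 of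
        the mass \<open>s\<close>, which is less than half.\<close>
      then have "r \<le> 2 * t" using sr by simp
      then have "R \<le> 2 * T'" unfolding r t using t
        by (simp add: ennreal_mult[symmetric] ennreal_numeral[symmetric] ennreal_leI del: ennreal_numeral)
      then show ?thesis by (simp only: R_def T'_def)
    qed
  qed
  have count: "real (card {j \<in> J. x \<in> T j}) \<le> (7 * ln (exp 1 + f x)) ^ (m - 2)" for x
  proof -
    define S where "S = {j \<in> J. x \<in> T j}"
    define v where "v j i = enn2real (emeasure (M i) (Q j i))" for j i
    define p where "p i B = enn2real (line_int i B F x)" for i B
    define a where "a j i = p i (Q j i) / v j i" for j i
    have SJ: "j \<in> J" if "j \<in> S" for j using that by (simp add: S_def)
    have v: "v j i > 0" "emeasure (M i) (Q j i) = ennreal (v j i)" if "j \<in> S" "i \<in> {1..m}" for j i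
      using pos[OF SJ[OF that(1)] that(2)] finite[OF SJ[OF that(1)] that(2)]
      unfolding v_def by (auto simp: enn2real_positive_iff)
    have p: "line_int i (Q j i) F x = ennreal (p i (Q j i))" if "j \<in> S" "i \<in> {1..m}" for j i
    proof -
      interpret R: rect_in_family M m "Q j" J Q by (rule fam[OF SJ[OF that(1)]])
      show "line_int i (Q j i) F x = ennreal (p i (Q j i))"
        using R.line_int_finite[of F "ennreal K" i x, OF FK Ktop that(2)] unfolding p_def by simp
    qed
    have p0: "p i B \<ge> 0" for i B by (simp add: p_def)
    have typx: "x \<in> rect_in_family.typical M m (Q j) J Q (L j) F \<eta> c" if "j \<in> S" for j
      using that by (simp add: S_def T_def)
    have xR: "x \<in> rect (Q j)" if "j \<in> S" for j
    proof -
      interpret R: rect_in_family M m "Q j" J Q by (rule fam[OF SJ[OF that(1)]])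
      show ?thesis using typx[OF that] by (simp add: R.typical_def)
    qed
    have lo: "1 / b \<le> a j i" if "j \<in> S" "i \<in> {1..m}" for j i
    proof -
      interpret R: rect_in_family M m "Q j" J Q by (rule fam[OF SJ[OF that(1)]])
      have "\<eta> * emeasure (M i) (Q j i) \<le> line_int i (Q j i) F x"
        using typx[OF that(1)] that(2) unfolding R.typical_def by blast
      then have "1 / b * v j i \<le> p i (Q j i)"
        using bpos v[OF that] p[OF that] p0 by (simp add: \<eta>_def ennreal_mult[symmetric])
      then show ?thesis using v(1)[OF that] bpos by (simp add: a_def field_simps)
    qed
    have hi: "a j i \<le> b * f x" if "j \<in> S" "i \<in> {1..m}" for j i
    proof -
      interpret R: rect_in_family M m "Q j" J Q by (rule fam[OF SJ[OF that(1)]])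
      have "\<eta> * line_int i (Q j i) F x \<le> F x * emeasure (M i) (Q j i)"
        using typx[OF that(1)] that(2) unfolding R.typical_def by blast
      then have "1 / b * p i (Q j i) \<le> f x * v j i"
        using bpos v[OF that] p[OF that] p0 f0[of x] by (simp add: \<eta>_def F_def ennreal_mult[symmetric])
      then show ?thesis using v(1)[OF that] bpos by (simp add: a_def field_simps)
    qed
    \<comment> \<open>Typicality is used for the rectangle \<open>l\<close> with the larger side,
      here in the role of \<open>A\<close>.\<close>
    have sub: "a l i \<le> b * a j i" if l: "l \<in> S" and j: "j \<in> S" and i: "i \<in> {1..m}" and "Q j i \<subseteq> Q l i" for l j i
    proof -
      interpret R: rect_in_family M m "Q l" J Q by (rule fam[OF SJ[OF l]])
      have "\<eta> * emeasure (M i) (Q j i) * line_int i (Q l i) F x \<le> line_int i (Q j i) F x * emeasure (M i) (Q l i)"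
        by (rule R.typical_subset[OF typx[OF l] SJ[OF j] i rect_mem[OF xR[OF j] i] that(4)])
      then have "1 / b * v j i * p i (Q l i) \<le> p i (Q j i) * v l i"
        using bpos v[OF l i] p[OF l i] v[OF j i] p[OF j i] p0 by (simp add: \<eta>_def ennreal_mult[symmetric])
      then show ?thesis using v(1)[OF l i] v(1)[OF j i] bpos by (simp add: a_def field_simps)
    qed
    have mono': "Q j m \<subseteq> Q l m" "\<exists>i\<in>{1..m - 1}. Q j i \<subseteq> Q l i" if l: "l \<in> S" and j: "j \<in> S" and lj: "l < j" for l j
      using mono[OF SJ[OF l] SJ[OF j] lj] xR[OF l] xR[OF j] by blast+
    have up: "\<exists>i\<in>{1..m - 1}. a l i \<le> b * a j i" if l: "l \<in> S" and j: "j \<in> S" and lj: "l < j" for l j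
    proof -
      obtain i where i: "i \<in> {1..m - 1}" "Q j i \<subseteq> Q l i" using mono'(2)[OF l j lj] by blast
      then have "i \<in> {1..m}" by auto
      from sub[OF l j this i(2)] show ?thesis using i(1) by blast
    qed
    have down: "\<exists>i\<in>{1..m - 1}. b\<^sup>2 * a j i < a l i" if l: "l \<in> S" and j: "j \<in> S" and lj: "l < j" for l j
    proof -
      interpret R: rect_in_family M m "Q j" J Q by (rule fam[OF SJ[OF j]])
      have lL: "l \<in> L j" using SJ[OF l] lj by (simp add: L_def)
      \<comment> \<open>Now typicality is used for the later rectangle \<open>j\<close>, with
        \<open>l\<close> one of its predecessors through \<open>x\<close>.\<close>
      from R.typical_drop[OF typx[OF j] LJ lL xR[OF l] FK Ktop \<eta>]
      obtain q where q: "q \<in> {1..m}" and less: "c * \<eta> * emeasure (M q) (Q l q \<inter> Q j q) * line_int q (Q j q) F x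
          < line_int q (Q l q \<inter> Q j q) F x * emeasure (M q) (Q j q)" by blast
      have c\<eta>: "c * \<eta> = ennreal (b\<^sup>2)"
        using bpos by (simp add: c_def \<eta>_def ennreal_mult[symmetric] power2_eq_square power3_eq_cube)
      have xq: "x q \<in> Q l q" "x q \<in> Q j q" using rect_mem[OF xR[OF l] q] rect_mem[OF xR[OF j] q] by auto
      note v' = v[OF l q] v[OF j q] and p' = p[OF l q] p[OF j q]
      \<comment> \<open>Otherwise both line integrals would run over \<open>Q j q\<close>, and the
        strict inequality would contradict \<open>b\<^sup>2 \<ge> 1\<close>.\<close>
      have nsub: "\<not> Q j q \<subseteq> Q l q"
      proof
        assume "Q j q \<subseteq> Q l q"
        then have eq: "Q l q \<inter> Q j q = Q j q" by blast
        have "ennreal (b\<^sup>2 * v j q * p q (Q j q)) < ennreal (p q (Q j q) * v j q)"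
          using less v' p' p0 unfolding c\<eta> eq by (simp add: ennreal_mult)
        then have "b\<^sup>2 * v j q * p q (Q j q) < p q (Q j q) * v j q"
          using v' p0 by (subst (asm) ennreal_less_iff) auto
        moreover have "1 * (v j q * p q (Q j q)) \<le> b\<^sup>2 * (v j q * p q (Q j q))"
          using v' p0 b56 by (intro mult_right_mono) (auto simp: one_le_power)
        ultimately show False by (simp add: mult_ac)
      qed
      then have "Q l q \<subseteq> Q j q" using laminar[OF SJ[OF l] SJ[OF j] q] xq by blast
      then have eq: "Q l q \<inter> Q j q = Q l q" by blast
      have "ennreal (b\<^sup>2 * v l q * p q (Q j q)) < ennreal (p q (Q l q) * v j q)"
        using less v' p' p0 unfolding c\<eta> eq by (simp add: ennreal_mult)
      then have "b\<^sup>2 * v l q * p q (Q j q) < p q (Q l q) * v j q"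
        using v' p0 by (subst (asm) ennreal_less_iff) auto
      then have "b\<^sup>2 * a j q < a l q"
        using v' by (simp add: a_def field_simps)
      \<comment> \<open>In direction \<open>m\<close> the earlier rectangle has the larger side, so
        the growth occurs in one of the other directions.\<close>
      moreover have "q \<noteq> m" using mono'(1)[OF l j lj] nsub by blast
      ultimately show ?thesis using q by (intro bexI[of _ q]) auto
    qed
    have be: "exp 1 \<le> b" using exp_le b56 by linarith
    have lo': "1 / b \<le> a j i" and hi': "a j i \<le> b * f x" if "j \<in> S" "i \<in> {1..m - 1}" for j i
      using lo[OF that(1)] hi[OF that(1)] that(2) by auto
    \<comment> \<open>Only the \<open>m - 1\<close> directions below \<open>m\<close> enter, and the
      diagonal removes one more: this is the exponent \<open>m - 2\<close>.\<close>
    have "real (card S) \<le> (7 * ln (exp 1 + f x)) ^ (m - 1 - 1)"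
      by (rule card_log_antichain[OF _ _ be f0 lo' hi' up down]) (use fin m in \<open>auto simp: S_def\<close>)
    moreover have "m - 1 - 1 = m - 2" using m by simp
    ultimately show ?thesis by (simp add: S_def)
  qed
  have "(\<Sum>j\<in>J. emeasure P (rect (Q j))) \<le> (\<Sum>j\<in>J. 2 * (\<integral>\<^sup>+x\<in>T j. F x \<partial>P))"
    using T_mass by (rule sum_mono)
  also have "\<dots> = 2 * (\<Sum>j\<in>J. \<integral>\<^sup>+x\<in>T j. F x \<partial>P)" by (simp add: sum_distrib_left)
  also have "(\<Sum>j\<in>J. \<integral>\<^sup>+x\<in>T j. F x \<partial>P) = (\<integral>\<^sup>+x. (\<Sum>j\<in>J. F x * indicator (T j) x) \<partial>P)"
    using F T_sets by (intro nn_integral_sum[symmetric] borel_measurable_times_ennreal borel_measurable_indicator)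
  also have "\<dots> \<le> (\<integral>\<^sup>+x. ennreal (f x * (7 * ln (exp 1 + f x)) ^ (m - 2)) \<partial>P)"
  proof (rule nn_integral_mono)
    fix x
    have "(\<Sum>j\<in>J. indicator (T j) x :: ennreal) = of_nat (card {j \<in> J. x \<in> T j})"
      using fin by (simp add: indicator_def sum.If_cases Int_def)
    then have "(\<Sum>j\<in>J. F x * indicator (T j) x) = ennreal (f x * real (card {j \<in> J. x \<in> T j}))"
      unfolding sum_distrib_left[symmetric] F_def using f0[of x]
      by (simp add: ennreal_mult ennreal_of_nat_eq_real_of_nat)
    also have "\<dots> \<le> ennreal (f x * (7 * ln (exp 1 + f x)) ^ (m - 2))"
      using count[of x] f0[of x] by (intro ennreal_leI mult_left_mono)
    finally show "(\<Sum>j\<in>J. F x * indicator (T j) x) \<le> ennreal (f x * (7 * ln (exp 1 + f x)) ^ (m - 2))" .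
  qed
  finally show ?thesis by (simp add: mult_left_mono)
qed

end

subsection \<open>Selection of a sparse subfamily\<close>

lemma borel_measurable_mult_ln_power:
  fixes f :: "'b \<Rightarrow> real"
  assumes "f \<in> borel_measurable N"
  shows "(\<lambda>x. ennreal (f x * ln (exp 1 + f x) ^ k)) \<in> borel_measurable N"
  using assms
  by (intro measurable_compose[OF _ measurable_ennreal] borel_measurable_times borel_measurable_power
      borel_measurable_ln borel_measurable_add borel_measurable_const)

text \<open>Indices are examined in increasing order, and one is kept if its set overlaps the kept
  predecessors in at most the fraction \<open>\<delta>\<close>. In the induction the new index is
  the largest, so earlier decisions stay valid.\<close>

lemma greedy_selection:
  fixes S :: "nat set" and R :: "nat \<Rightarrow> 'b set"
  assumes "finite S"
  shows "\<exists>J\<subseteq>S. (\<forall>j\<in>J. emeasure N (R j \<inter> (\<Union>l\<in>{l \<in> J. l < j}. R l)) \<le> \<delta> * emeasure N (R j)) \<and>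
    (\<forall>j\<in>S - J. \<delta> * emeasure N (R j) < emeasure N (R j \<inter> (\<Union>l\<in>{l \<in> J. l < j}. R l)))"
  using assms
proof (induction S rule: finite_linorder_max_induct)
  case (insert b S)
  then obtain J where J: "J \<subseteq> S"
    and sel: "\<And>j. j \<in> J \<Longrightarrow> emeasure N (R j \<inter> (\<Union>l\<in>{l \<in> J. l < j}. R l)) \<le> \<delta> * emeasure N (R j)"
    and unsel: "\<And>j. j \<in> S - J \<Longrightarrow> \<delta> * emeasure N (R j) < emeasure N (R j \<inter> (\<Union>l\<in>{l \<in> J. l < j}. R l))"
    by blast
  show ?case
  proof (cases "emeasure N (R b \<inter> (\<Union>l\<in>{l \<in> J. l < b}. R l)) \<le> \<delta> * emeasure N (R b)")
    case True
    have eq: "{l \<in> insert b J. l < j} = {l \<in> J. l < j}" if "j \<in> insert b S" for j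
      using that insert.hyps J by auto
    show ?thesis
    proof (intro exI[of _ "insert b J"] conjI ballI)
      fix j assume j: "j \<in> insert b J"
      then show "emeasure N (R j \<inter> (\<Union>l\<in>{l \<in> insert b J. l < j}. R l)) \<le> \<delta> * emeasure N (R j)"
        using True sel J by (subst eq) auto
    next
      fix j assume j: "j \<in> insert b S - insert b J"
      then have "j \<in> S - J" by blast
      from unsel[OF this] show "\<delta> * emeasure N (R j) < emeasure N (R j \<inter> (\<Union>l\<in>{l \<in> insert b J. l < j}. R l))"
        using j by (subst eq) auto
    qed (use J in auto)
  next
    case False
    then show ?thesis using sel unsel J by (intro exI[of _ J]) (auto simp: not_le)
  qed
qed simp

text \<open>Chosen so that \<open>((28 * m) ^ 3) ^ m\<close> times this ratio is 1/8, as the mass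
  balance in \<open>sparse_family_sum\<close> requires.\<close>

definition selection_ratio :: "nat \<Rightarrow> real" where
  "selection_ratio m = (1 / (28 * real m)) ^ (3 * m) / 8"

text \<open>The first factor is the loss in passing from the whole union to the selected rectangles;
  the 2 and the power of 7 come from \<open>sparse_family_sum\<close>.\<close>

definition bound_const :: "nat \<Rightarrow> real" where
  "bound_const m = (2 ^ m / selection_ratio m) ^ m * 2 * 7 ^ (m - 2)"

section \<open>Control of the union by the selected rectangles\<close>

context finite_product begin

text \<open>Superlevel sets of one-dimensional maximal functions over the sides, taken direction
  after direction: a substitute for the maximal function over the rectangles.\<close>

primrec line_dense :: "(nat \<Rightarrow> nat \<Rightarrow> 'a set) \<Rightarrow> nat set \<Rightarrow> ennreal \<Rightarrow> (nat \<Rightarrow> 'a) set \<Rightarrow> nat \<Rightarrow> (nat \<Rightarrow> 'a) set" where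
  "line_dense Q S \<theta> U 0 = U"
| "line_dense Q S \<theta> U (Suc k) = {x \<in> space P. \<exists>j\<in>S. x (Suc k) \<in> Q j (Suc k) \<and>
     \<theta> * emeasure (M (Suc k)) (Q j (Suc k)) \<le> line_int (Suc k) (Q j (Suc k)) (indicator (line_dense Q S \<theta> U k)) x}"

text \<open>Each of the \<open>m\<close> one-dimensional steps enlarges the measure by at most
  \<open>1 / \<theta>\<close>, by the weak type inequality on lines. A rectangle with density
  \<open>\<delta>\<close> of \<open>U\<close> is swallowed by the last set, because density passes
  from one direction to the next at the cost of a factor 2.\<close>

lemma emeasure_union_dense_le:
  fixes Q :: "nat \<Rightarrow> nat \<Rightarrow> 'a set"
  assumes fin: "finite S"
    and sets: "\<And>j i. j \<in> S \<Longrightarrow> i \<in> {1..m} \<Longrightarrow> Q j i \<in> sets (M i)"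
    and pos: "\<And>j i. j \<in> S \<Longrightarrow> i \<in> {1..m} \<Longrightarrow> 0 < emeasure (M i) (Q j i)"
    and finite: "\<And>j i. j \<in> S \<Longrightarrow> i \<in> {1..m} \<Longrightarrow> emeasure (M i) (Q j i) < \<infinity>"
    and laminar: "\<And>l j i. l \<in> S \<Longrightarrow> j \<in> S \<Longrightarrow> i \<in> {1..m} \<Longrightarrow>
      Q l i \<inter> Q j i = {} \<or> Q l i \<subseteq> Q j i \<or> Q j i \<subseteq> Q l i"
    and \<delta>: "0 < \<delta>" and U: "U \<in> sets P"
    and dense: "\<And>j. j \<in> S \<Longrightarrow> ennreal \<delta> * emeasure P (rect (Q j)) \<le> emeasure P (rect (Q j) \<inter> U)"
  shows "emeasure P (\<Union>j\<in>S. rect (Q j)) \<le> ennreal ((2 ^ m / \<delta>) ^ m) * emeasure P U"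
proof -
  \<comment> \<open>A lower bound for all thresholds \<open>\<delta> / 2 ^ (m - k)\<close> met
    below, so that one value serves every direction.\<close>
  define \<theta> where "\<theta> = \<delta> / 2 ^ m"
  have \<theta>: "0 < \<theta>" using \<delta> by (simp add: \<theta>_def)
  define V where "V = line_dense Q S (ennreal \<theta>) U"
  have V0: "V 0 = U" and VS: "V (Suc k) = {x \<in> space P. \<exists>j\<in>S. x (Suc k) \<in> Q j (Suc k) \<and>
     ennreal \<theta> * emeasure (M (Suc k)) (Q j (Suc k)) \<le> line_int (Suc k) (Q j (Suc k)) (indicator (V k)) x}" for k
    by (simp_all add: V_def)
  have V: "V k \<in> sets P" if "k \<le> m" for k
    using that
  proof (induction k)
    case (Suc k)
    then have i: "Suc k \<in> {1..m}" and Vk: "V k \<in> sets P" by auto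
    have "V (Suc k) = (\<Union>j\<in>S. {x \<in> space P. x (Suc k) \<in> Q j (Suc k)} \<inter> {x \<in> space P.
        ennreal \<theta> * emeasure (M (Suc k)) (Q j (Suc k)) \<le> line_int (Suc k) (Q j (Suc k)) (indicator (V k)) x})"
      unfolding VS by blast
    also have "\<dots> \<in> sets P"
    proof (intro sets.finite_UN fin sets.Int)
      fix j assume j: "j \<in> S"
      show "{x \<in> space P. x (Suc k) \<in> Q j (Suc k)} \<in> sets P"
        using sets[OF j i] i by (intro measurable_sets_Collect[OF measurable_component_singleton]) auto
      have [measurable]: "line_int (Suc k) (Q j (Suc k)) (indicator (V k)) \<in> borel_measurable P"
        using i Vk sets[OF j i] by (intro line_int_measurable) auto
      show "{x \<in> space P. ennreal \<theta> * emeasure (M (Suc k)) (Q j (Suc k))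
          \<le> line_int (Suc k) (Q j (Suc k)) (indicator (V k)) x} \<in> sets P" by measurable
    qed
    finally show ?case .
  qed (use U V0 in simp)
  have one: "ennreal (1 / \<theta>) * ennreal \<theta> = 1"
    using \<theta> by (simp add: ennreal_mult[symmetric])
  have step: "emeasure P (V (Suc k)) \<le> ennreal (1 / \<theta>) * emeasure P (V k)" if k: "Suc k \<le> m" for k
  proof -
    have i: "Suc k \<in> {1..m}" using k by auto
    have Vk: "V k \<in> sets P" using V[of k] k by auto
    have "(\<integral>\<^sup>+x\<in>V (Suc k). 1 \<partial>P) \<le> (\<integral>\<^sup>+x\<in>space P. ennreal (1 / \<theta>) * indicator (V k) x \<partial>P)"
    proof (rule line_laminar[OF i _ _ V[OF k] sets.top, where \<G> = "(\<lambda>j. Q j (Suc k)) ` S"])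
      fix x assume x: "x \<in> V (Suc k)"
      then obtain j where j: "j \<in> S" and xj: "x (Suc k) \<in> Q j (Suc k)" and xP: "x \<in> space P"
        and le: "ennreal \<theta> * emeasure (M (Suc k)) (Q j (Suc k)) \<le> line_int (Suc k) (Q j (Suc k)) (indicator (V k)) x"
        unfolding VS by blast
      have "line_int (Suc k) (Q j (Suc k)) (\<lambda>_. 1) x = ennreal (1 / \<theta>) * (ennreal \<theta> * emeasure (M (Suc k)) (Q j (Suc k)))"
        using sets[OF j i] by (simp add: line_int_invariant[where c = 1] mult.assoc[symmetric] one)
      also have "\<dots> \<le> ennreal (1 / \<theta>) * line_int (Suc k) (Q j (Suc k)) (indicator (V k)) x"
        using le by (rule mult_left_mono) simp
      also have "\<dots> = line_int (Suc k) (Q j (Suc k)) (\<lambda>x. ennreal (1 / \<theta>) * indicator (V k) x) x"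
        using Vk sets[OF j i] by (intro line_int_cmult[OF i _ xP, symmetric]) auto
      finally show "\<exists>C\<in>(\<lambda>j. Q j (Suc k)) ` S. x (Suc k) \<in> C \<and> (\<forall>t\<in>C. x(Suc k := t) \<in> space P) \<and>
          line_int (Suc k) C (\<lambda>_. 1) x \<le> line_int (Suc k) C (\<lambda>x. ennreal (1 / \<theta>) * indicator (V k) x) x"
        using j xj upd_space[OF i xP] sets.sets_into_space[OF sets[OF j i]] by blast
    next
      fix C D assume "C \<in> (\<lambda>j. Q j (Suc k)) ` S" "D \<in> (\<lambda>j. Q j (Suc k)) ` S"
      then show "C \<inter> D = {} \<or> C \<subseteq> D \<or> D \<subseteq> C" using laminar[OF _ _ i] by blast
    qed (use fin sets i Vk in auto)
    also have "\<dots> = (\<integral>\<^sup>+x. ennreal (1 / \<theta>) * indicator (V k) x \<partial>P)"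
      by (intro nn_integral_cong) auto
    finally show ?thesis using V[OF k] Vk by (simp add: nn_integral_cmult_indicator)
  qed
  have iter: "emeasure P (V k) \<le> ennreal ((1 / \<theta>) ^ k) * emeasure P U" if "k \<le> m" for k
    using that
  proof (induction k)
    case (Suc k)
    have "emeasure P (V (Suc k)) \<le> ennreal (1 / \<theta>) * emeasure P (V k)" using step Suc.prems by auto
    also have "\<dots> \<le> ennreal (1 / \<theta>) * (ennreal ((1 / \<theta>) ^ k) * emeasure P U)"
      using Suc by (intro mult_left_mono) auto
    also have "\<dots> = ennreal ((1 / \<theta>) ^ Suc k) * emeasure P U"
    proof -
      have "ennreal ((1 / \<theta>) ^ Suc k) = ennreal (1 / \<theta>) * ennreal ((1 / \<theta>) ^ k)"
        unfolding power_Suc using \<theta> by (intro ennreal_mult) auto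
      then show ?thesis by (simp only: mult.assoc)
    qed
    finally show ?case .
  qed (simp add: V0)
  have sub: "rect (Q j) \<subseteq> V m" if j: "j \<in> S" for j
  proof -
    interpret R: product_rect M m "Q j"
      using sets pos finite j by unfold_locales auto
    define G where "G = iter_avg (Q j) (indicator U)"
    have iU: "indicator U \<in> borel_measurable P" using U by simp
    have G1: "G k x \<le> 1" if "k \<le> m" for k x
      unfolding G_def using that by (intro R.iter_avg_le) (auto simp: indicator_def)
    \<comment> \<open>\<open>G k\<close> is the density of \<open>U\<close> in the slice of the
      rectangle through \<open>x\<close> spanned by the first \<open>k\<close> directions; each
      stage asks for half the density of the next one.\<close>
    have *: "x \<in> V k" if "k \<le> m" "x \<in> rect (Q j)" "ennreal (\<delta> / 2 ^ (m - k)) \<le> G k x" for k x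
      using that
    proof (induction k arbitrary: x)
      case 0
      have "0 < ennreal (\<delta> / 2 ^ m)" using \<delta> by simp
      moreover have "ennreal (\<delta> / 2 ^ m) \<le> G 0 x" using 0(3) by simp
      ultimately have "0 < G 0 x" by (rule less_le_trans)
      then show ?case by (cases "x \<in> U") (auto simp: G_def V0)
    next
      case (Suc k)
      have i: "Suc k \<in> {1..m}" using Suc.prems by auto
      have xP: "x \<in> space P" using Suc.prems(2) sets.sets_into_space[OF R.rect_sets] by blast
      have Vk: "V k \<in> sets P" using V[of k] Suc.prems by auto
      define A where "A = Q j (Suc k)"
      define a where "a = emeasure (M (Suc k)) A"
      have A: "A \<in> sets (M (Suc k))" using sets[OF j i] by (simp add: A_def)
      define \<epsilon> where "\<epsilon> = \<delta> / 2 ^ (m - k)"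
      have \<epsilon>0: "\<epsilon> > 0" using \<delta> by (simp add: \<epsilon>_def)
      have mk: "m - k = Suc (m - Suc k)" using Suc.prems by simp
      have \<epsilon>2: "\<delta> / 2 ^ (m - Suc k) = \<epsilon> + \<epsilon>" unfolding \<epsilon>_def mk by simp
      have afin: "a < top" using finite[OF j i] by (simp add: a_def A_def)
      have "ennreal (\<epsilon> + \<epsilon>) * a \<le> line_int (Suc k) A (G k) x"
        using Suc.prems(3) unfolding \<epsilon>2 G_def iter_avg.simps A_def a_def R.le_divide_A[OF i] .
      \<comment> \<open>On \<open>A\<close> the density is at most \<open>\<epsilon>\<close> off
        \<open>V k\<close>, by the induction hypothesis, and at most 1 on it. A line average of
        \<open>2 * \<epsilon>\<close> therefore forces density \<open>\<epsilon>\<close> of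
        \<open>V k\<close> on the line.\<close>
      also have "\<dots> \<le> (\<integral>\<^sup>+t. ennreal \<epsilon> * indicator A t + indicator (V k) (x(Suc k := t)) * indicator A t \<partial>M (Suc k))"
        unfolding line_int_def
      proof (rule nn_integral_mono)
        fix t
        show "G k (x(Suc k := t)) * indicator A t \<le> ennreal \<epsilon> * indicator A t + indicator (V k) (x(Suc k := t)) * indicator A t"
        proof (cases "t \<in> A")
          case True
          then have "x(Suc k := t) \<in> rect (Q j)" using rect_upd[OF Suc.prems(2) i] by (simp add: A_def)
          moreover have IH: "y \<in> V k" if "y \<in> rect (Q j)" "ennreal \<epsilon> \<le> G k y" for y
            using Suc.IH[of y] Suc.prems(1) that by (simp add: \<epsilon>_def)
          ultimately have V_if: "x(Suc k := t) \<in> V k" if "ennreal \<epsilon> \<le> G k (x(Suc k := t))"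
            using that by blast
          show ?thesis
          proof (cases "ennreal \<epsilon> \<le> G k (x(Suc k := t))")
            case ge: True
            have "G k (x(Suc k := t)) \<le> 1" using G1 Suc.prems(1) by simp
            then show ?thesis using True V_if[OF ge] by (simp add: add_increasing)
          next
            case False
            then have "G k (x(Suc k := t)) \<le> ennreal \<epsilon>" by simp
            then show ?thesis using True by (simp add: add_increasing2)
          qed
        qed simp
      qed
      also have "\<dots> = ennreal \<epsilon> * a + line_int (Suc k) A (indicator (V k)) x"
      proof -
        have "(\<lambda>t. indicator (V k) (x(Suc k := t)) :: ennreal) \<in> borel_measurable (M (Suc k))"
          using Vk by (intro line_measurable[OF i _ xP]) auto
        then show ?thesis
          unfolding line_int_def a_def using A
          by (subst nn_integral_add) (auto simp: nn_integral_cmult_indicator)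
      qed
      finally have dbl: "ennreal (\<epsilon> + \<epsilon>) * a \<le> ennreal \<epsilon> * a + line_int (Suc k) A (indicator (V k)) x" .
      then have "ennreal \<epsilon> * a + ennreal \<epsilon> * a \<le> ennreal \<epsilon> * a + line_int (Suc k) A (indicator (V k)) x"
      proof -
        have "ennreal (\<epsilon> + \<epsilon>) * a = ennreal \<epsilon> * a + ennreal \<epsilon> * a"
          using \<epsilon>0 by (subst ennreal_plus) (auto simp: distrib_right)
        with dbl show ?thesis by (simp only:)
      qed
      then have "ennreal \<epsilon> * a \<le> line_int (Suc k) A (indicator (V k)) x"
        using afin by (subst (asm) ennreal_add_left_cancel_le) (auto simp: ennreal_mult_eq_top_iff)
      moreover have "ennreal \<theta> * a \<le> ennreal \<epsilon> * a"
      proof (intro mult_right_mono ennreal_leI)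
        show "\<theta> \<le> \<epsilon>" unfolding \<theta>_def \<epsilon>_def using \<delta> by (intro divide_left_mono power_increasing) auto
      qed simp
      ultimately have "ennreal \<theta> * a \<le> line_int (Suc k) A (indicator (V k)) x" by (rule order_trans[rotated])
      then show ?case
        unfolding VS using j xP rect_mem[OF Suc.prems(2) i] unfolding a_def A_def by blast
    qed
    show ?thesis
    proof
      fix x assume x: "x \<in> rect (Q j)"
      have "G m x * emeasure P (rect (Q j)) = (\<integral>\<^sup>+x\<in>rect (Q j). indicator U x \<partial>P)"
        unfolding G_def by (rule R.iter_avg_full[OF iU x])
      also have "\<dots> = emeasure P (rect (Q j) \<inter> U)"
      proof -
        have "(\<integral>\<^sup>+x\<in>rect (Q j). indicator U x \<partial>P) = (\<integral>\<^sup>+x. indicator (rect (Q j) \<inter> U) x \<partial>P)"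
          by (intro nn_integral_cong) (simp add: indicator_inter_arith mult.commute)
        also have "\<dots> = emeasure P (rect (Q j) \<inter> U)"
          using U R.rect_sets by (intro nn_integral_indicator) blast
        finally show ?thesis .
      qed
      finally have "ennreal \<delta> * emeasure P (rect (Q j)) \<le> G m x * emeasure P (rect (Q j))"
        using dense[OF j] by simp
      then have "ennreal \<delta> \<le> G m x"
        using R.emeasure_rect_pos R.emeasure_rect_finite
        by (subst (asm) (1 2) mult.commute, subst (asm) ennreal_mult_le_mult_iff) auto
      then show "x \<in> V m" using *[of m x] x by simp
    qed
  qed
  have "emeasure P (\<Union>j\<in>S. rect (Q j)) \<le> emeasure P (V m)"
    using sub V[of m] by (intro emeasure_mono) auto
  also have "\<dots> \<le> ennreal ((1 / \<theta>) ^ m) * emeasure P U" by (rule iter) simp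
  finally show ?thesis by (simp add: \<theta>_def)
qed

text \<open>A rejected rectangle has more than the fraction \<open>\<delta>\<close> of its measure
  in the selected union \<open>U\<close>. So \<open>emeasure_union_dense_le\<close> reduces the
  whole union to \<open>U\<close>, and \<open>sparse_family_sum\<close> controls
  \<open>U\<close>.\<close>

lemma normalized_family_bound:
  fixes f :: "(nat \<Rightarrow> 'a) \<Rightarrow> real" and Q :: "nat \<Rightarrow> nat \<Rightarrow> 'a set"
  assumes m: "m \<ge> 2" and fin: "finite S"
    and sets: "\<And>j i. j \<in> S \<Longrightarrow> i \<in> {1..m} \<Longrightarrow> Q j i \<in> sets (M i)"
    and pos: "\<And>j i. j \<in> S \<Longrightarrow> i \<in> {1..m} \<Longrightarrow> 0 < emeasure (M i) (Q j i)"
    and finite: "\<And>j i. j \<in> S \<Longrightarrow> i \<in> {1..m} \<Longrightarrow> emeasure (M i) (Q j i) < \<infinity>"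
    and laminar: "\<And>l j i. l \<in> S \<Longrightarrow> j \<in> S \<Longrightarrow> i \<in> {1..m} \<Longrightarrow>
      Q l i \<inter> Q j i = {} \<or> Q l i \<subseteq> Q j i \<or> Q j i \<subseteq> Q l i"
    and mono: "\<And>l j. l \<in> S \<Longrightarrow> j \<in> S \<Longrightarrow> l < j \<Longrightarrow> rect (Q l) \<inter> rect (Q j) \<noteq> {} \<Longrightarrow>
      Q j m \<subseteq> Q l m \<and> (\<exists>i\<in>{1..m - 1}. Q j i \<subseteq> Q l i)"
    and f: "f \<in> borel_measurable P" and f0: "\<And>x. 0 \<le> f x" and fK: "\<And>x. f x \<le> K"
    and avg: "\<And>j. j \<in> S \<Longrightarrow> emeasure P (rect (Q j)) \<le> (\<integral>\<^sup>+x\<in>rect (Q j). ennreal (f x) \<partial>P)"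
      "\<And>j. j \<in> S \<Longrightarrow> (\<integral>\<^sup>+x\<in>rect (Q j). ennreal (f x) \<partial>P) \<le> 2 * emeasure P (rect (Q j))"
  shows "emeasure P (\<Union>j\<in>S. rect (Q j)) \<le> ennreal (bound_const m) * (\<integral>\<^sup>+x. ennreal (f x * ln (exp 1 + f x) ^ (m - 2)) \<partial>P)"
proof -
  define \<delta> where "\<delta> = selection_ratio m"
  have \<delta>: "0 < \<delta>" using m by (simp add: \<delta>_def selection_ratio_def)
  have \<delta>1: "\<delta> \<le> 1"
  proof -
    have "(1 / (28 * real m)) ^ (3 * m) \<le> 1" using m by (intro power_le_one) auto
    then show ?thesis by (simp add: \<delta>_def selection_ratio_def)
  qed
  obtain J where J: "J \<subseteq> S"
    and sel: "\<And>j. j \<in> J \<Longrightarrow> emeasure P (rect (Q j) \<inter> (\<Union>l\<in>{l \<in> J. l < j}. rect (Q l))) \<le> ennreal \<delta> * emeasure P (rect (Q j))"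
    and unsel: "\<And>j. j \<in> S - J \<Longrightarrow> ennreal \<delta> * emeasure P (rect (Q j)) < emeasure P (rect (Q j) \<inter> (\<Union>l\<in>{l \<in> J. l < j}. rect (Q l)))"
    using greedy_selection[OF fin, of P "\<lambda>j. rect (Q j)" "ennreal \<delta>"] by blast
  have finJ: "Finite_Set.finite J" using fin J by (rule finite_subset[rotated])
  have JS: "j \<in> S" if "j \<in> J" for j using that J by blast
  define U where "U = (\<Union>j\<in>J. rect (Q j))"
  have rs: "rect (Q j) \<in> sets P" if "j \<in> S" for j
    unfolding rect_def using sets[OF that] by (intro sets_PiM_I_finite) auto
  have U: "U \<in> sets P" unfolding U_def using rs J finJ by (intro sets.finite_UN) auto
  have dense: "ennreal \<delta> * emeasure P (rect (Q j)) \<le> emeasure P (rect (Q j) \<inter> U)" if j: "j \<in> S" for j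
  proof (cases "j \<in> J")
    case True
    then have "rect (Q j) \<inter> U = rect (Q j)" by (auto simp: U_def)
    moreover have "ennreal \<delta> * emeasure P (rect (Q j)) \<le> 1 * emeasure P (rect (Q j))"
      using \<delta>1 by (intro mult_right_mono) (auto simp: ennreal_le_1)
    ultimately show ?thesis by simp
  next
    case False
    have "ennreal \<delta> * emeasure P (rect (Q j)) \<le> emeasure P (rect (Q j) \<inter> (\<Union>l\<in>{l \<in> J. l < j}. rect (Q l)))"
      using unsel[of j] j False by auto
    also have "\<dots> \<le> emeasure P (rect (Q j) \<inter> U)"
      using U rs[OF j] by (intro emeasure_mono sets.Int) (auto simp: U_def)
    finally show ?thesis .
  qed
  have union: "emeasure P (\<Union>j\<in>S. rect (Q j)) \<le> ennreal ((2 ^ m / \<delta>) ^ m) * emeasure P U"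
    by (rule emeasure_union_dense_le[OF fin sets pos finite laminar \<delta> U dense])
  have "emeasure P U \<le> (\<Sum>j\<in>J. emeasure P (rect (Q j)))"
    unfolding U_def using rs J by (intro emeasure_subadditive_finite finJ) auto
  also have "\<dots> \<le> 2 * (\<integral>\<^sup>+x. ennreal (f x * (7 * ln (exp 1 + f x)) ^ (m - 2)) \<partial>P)"
    by (rule sparse_family_sum[OF m finJ sets[OF JS] pos[OF JS] finite[OF JS] laminar[OF JS JS] mono[OF JS JS]
          sel[unfolded \<delta>_def selection_ratio_def] f f0 fK avg(1)[OF JS] avg(2)[OF JS]])
  also have "(\<integral>\<^sup>+x. ennreal (f x * (7 * ln (exp 1 + f x)) ^ (m - 2)) \<partial>P)
      = (\<integral>\<^sup>+x. ennreal (7 ^ (m - 2)) * ennreal (f x * ln (exp 1 + f x) ^ (m - 2)) \<partial>P)"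
  proof (rule nn_integral_cong)
    fix x
    have "f x * (7 * ln (exp 1 + f x)) ^ (m - 2) = 7 ^ (m - 2) * (f x * ln (exp 1 + f x) ^ (m - 2))"
      by (simp add: power_mult_distrib)
    then show "ennreal (f x * (7 * ln (exp 1 + f x)) ^ (m - 2)) = ennreal (7 ^ (m - 2)) * ennreal (f x * ln (exp 1 + f x) ^ (m - 2))"
      by (simp only: ennreal_mult'[of "7 ^ (m - 2)"] zero_le_power zero_le_numeral)
  qed
  also have "\<dots> = ennreal (7 ^ (m - 2)) * (\<integral>\<^sup>+x. ennreal (f x * ln (exp 1 + f x) ^ (m - 2)) \<partial>P)"
    by (intro nn_integral_cmult borel_measurable_mult_ln_power f)
  finally have "emeasure P U \<le> 2 * (ennreal (7 ^ (m - 2)) * (\<integral>\<^sup>+x. ennreal (f x * ln (exp 1 + f x) ^ (m - 2)) \<partial>P))" .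
  from order_trans[OF union mult_left_mono[OF this]]
  have "emeasure P (\<Union>j\<in>S. rect (Q j)) \<le> ennreal ((2 ^ m / \<delta>) ^ m) * (2 * (ennreal (7 ^ (m - 2)) *
      (\<integral>\<^sup>+x. ennreal (f x * ln (exp 1 + f x) ^ (m - 2)) \<partial>P)))" by simp
  moreover have "ennreal ((2 ^ m / \<delta>) ^ m) * (2 * ennreal (7 ^ (m - 2))) = ennreal (bound_const m)"
    using \<delta> by (simp add: bound_const_def \<delta>_def[symmetric] ennreal_mult mult_ac)
  ultimately show ?thesis by (simp only: mult.assoc[symmetric])
qed

text \<open>Rectangles with average between \<open>2 ^ s\<close> and \<open>2 ^ Suc s\<close> become
  normalized when \<open>f\<close> is divided by \<open>2 ^ s\<close>. The bound for that class
  gains the factor \<open>(1 / 2) ^ s\<close>, and the geometric series contributes 2.\<close>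

lemma family_bound:
  fixes f :: "(nat \<Rightarrow> 'a) \<Rightarrow> real" and Q :: "nat \<Rightarrow> nat \<Rightarrow> 'a set"
  assumes m: "m \<ge> 2" and fin: "finite S"
    and sets: "\<And>j i. j \<in> S \<Longrightarrow> i \<in> {1..m} \<Longrightarrow> Q j i \<in> sets (M i)"
    and pos: "\<And>j i. j \<in> S \<Longrightarrow> i \<in> {1..m} \<Longrightarrow> 0 < emeasure (M i) (Q j i)"
    and finite: "\<And>j i. j \<in> S \<Longrightarrow> i \<in> {1..m} \<Longrightarrow> emeasure (M i) (Q j i) < \<infinity>"
    and laminar: "\<And>l j i. l \<in> S \<Longrightarrow> j \<in> S \<Longrightarrow> i \<in> {1..m} \<Longrightarrow>
      Q l i \<inter> Q j i = {} \<or> Q l i \<subseteq> Q j i \<or> Q j i \<subseteq> Q l i"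
    and mono: "\<And>l j. l \<in> S \<Longrightarrow> j \<in> S \<Longrightarrow> l < j \<Longrightarrow> rect (Q l) \<inter> rect (Q j) \<noteq> {} \<Longrightarrow>
      Q j m \<subseteq> Q l m \<and> (\<exists>i\<in>{1..m - 1}. Q j i \<subseteq> Q l i)"
    and f: "f \<in> borel_measurable P" and f0: "\<And>x. 0 \<le> f x" and fK: "\<And>x. f x \<le> K"
    and avg: "\<And>j. j \<in> S \<Longrightarrow> emeasure P (rect (Q j)) \<le> (\<integral>\<^sup>+x\<in>rect (Q j). ennreal (f x) \<partial>P)"
  shows "emeasure P (\<Union>j\<in>S. rect (Q j)) \<le> ennreal (2 * bound_const m) * (\<integral>\<^sup>+x. ennreal (f x * ln (exp 1 + f x) ^ (m - 2)) \<partial>P)"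
proof -
  define I where "I = (\<integral>\<^sup>+x. ennreal (f x * ln (exp 1 + f x) ^ (m - 2)) \<partial>P)"
  define g where "g j = (\<integral>\<^sup>+x\<in>rect (Q j). ennreal (f x) \<partial>P)" for j
  have rs: "rect (Q j) \<in> sets P" if "j \<in> S" for j
    unfolding rect_def using sets[OF that] by (intro sets_PiM_I_finite) auto
  \<comment> \<open>Averages cannot exceed \<open>K\<close>, so only the classes up to
    \<open>n\<close> occur.\<close>
  obtain n where n: "K \<le> 2 ^ n" using real_arch_pow[of 2 K] by (auto intro: less_imp_le)
  define S' where "S' s = {j \<in> S. ennreal (2 ^ s) * emeasure P (rect (Q j)) \<le> g j \<and> g j \<le> ennreal (2 ^ Suc s) * emeasure P (rect (Q j))}" for s :: nat
  have cover: "\<exists>s<Suc n. j \<in> S' s" if j: "j \<in> S" for j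
  proof -
    \<comment> \<open>Minimality yields the lower bound on the average through \<open>s - 1\<close>;
      for \<open>s = 0\<close> that bound is \<open>avg\<close>.\<close>
    define s where "s = (LEAST s. g j \<le> ennreal (2 ^ Suc s) * emeasure P (rect (Q j)))"
    have "g j \<le> (\<integral>\<^sup>+x. ennreal (2 ^ n) * indicator (rect (Q j)) x \<partial>P)"
      unfolding g_def by (intro nn_integral_mono mult_right_mono ennreal_leI order_trans[OF fK n]) simp
    also have "\<dots> = ennreal (2 ^ n) * emeasure P (rect (Q j))"
      using rs[OF j] by (rule nn_integral_cmult_indicator)
    also have "\<dots> \<le> ennreal (2 ^ Suc n) * emeasure P (rect (Q j))"
      by (intro mult_right_mono ennreal_leI) auto
    finally have ex: "g j \<le> ennreal (2 ^ Suc n) * emeasure P (rect (Q j))" .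
    have s1: "g j \<le> ennreal (2 ^ Suc s) * emeasure P (rect (Q j))" unfolding s_def
      by (rule LeastI[where P = "\<lambda>s. g j \<le> ennreal (2 ^ Suc s) * emeasure P (rect (Q j))", OF ex])
    have "s \<le> n" unfolding s_def
      by (rule Least_le[where P = "\<lambda>s. g j \<le> ennreal (2 ^ Suc s) * emeasure P (rect (Q j))", OF ex])
    moreover have "ennreal (2 ^ s) * emeasure P (rect (Q j)) \<le> g j"
    proof (cases s)
      case 0
      then show ?thesis using avg[OF j] by (simp add: g_def)
    next
      case (Suc r)
      then have "\<not> g j \<le> ennreal (2 ^ Suc r) * emeasure P (rect (Q j))" unfolding s_def
        by (metis lessI not_less_Least)
      then show ?thesis unfolding Suc by simp
    qed
    ultimately show ?thesis using s1 j unfolding S'_def by (intro exI[of _ s]) simp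
  qed
  have level: "emeasure P (\<Union>j\<in>S' s. rect (Q j)) \<le> ennreal (bound_const m) * (ennreal ((1 / 2) ^ s) * I)" for s
  proof -
    have SS: "j \<in> S" if "j \<in> S' s" for j using that by (simp add: S'_def)
    have finS: "Finite_Set.finite (S' s)" using fin by (simp add: S'_def)
    define h where "h x = f x / 2 ^ s" for x
    have hint: "(\<integral>\<^sup>+x\<in>rect (Q j). ennreal (h x) \<partial>P) = ennreal ((1 / 2) ^ s) * g j" if "j \<in> S" for j
    proof -
      have "(\<integral>\<^sup>+x\<in>rect (Q j). ennreal (h x) \<partial>P) = (\<integral>\<^sup>+x. ennreal ((1 / 2) ^ s) * (ennreal (f x) * indicator (rect (Q j)) x) \<partial>P)"
        unfolding h_def using f0
        by (intro nn_integral_cong) (simp add: mult.assoc[symmetric] ennreal_mult[symmetric] power_divide)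
      also have "\<dots> = ennreal ((1 / 2) ^ s) * g j"
        unfolding g_def using rs[OF that]
        by (intro nn_integral_cmult borel_measurable_times_ennreal borel_measurable_indicator measurable_compose[OF f measurable_ennreal])
      finally show ?thesis .
    qed
    have pw: "ennreal ((1 / 2) ^ s) * (ennreal (2 ^ s) * z) = z" "ennreal ((1 / 2) ^ s) * (ennreal (2 ^ Suc s) * z) = 2 * z" for z
    proof -
      have "(1 / 2) ^ s * 2 ^ s = (1::real)" by (simp add: power_mult_distrib[symmetric])
      then have *: "ennreal ((1 / 2) ^ s) * ennreal (2 ^ s) = 1" by (simp add: ennreal_mult[symmetric])
      then show "ennreal ((1 / 2) ^ s) * (ennreal (2 ^ s) * z) = z" by (simp only: mult.assoc[symmetric] mult_1)
      have "ennreal (2 ^ Suc s) = ennreal (2 ^ s) * 2" by (simp add: ennreal_mult mult.commute)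
      then show "ennreal ((1 / 2) ^ s) * (ennreal (2 ^ Suc s) * z) = 2 * z" by (simp only: mult.assoc[symmetric] * mult_1)
    qed
    have union: "emeasure P (\<Union>j\<in>S' s. rect (Q j)) \<le> ennreal (bound_const m) * (\<integral>\<^sup>+x. ennreal (h x * ln (exp 1 + h x) ^ (m - 2)) \<partial>P)"
    proof (rule normalized_family_bound[OF m finS sets[OF SS] pos[OF SS] finite[OF SS] laminar[OF SS SS] mono[OF SS SS], where K = "K / 2 ^ s"])
      show "h \<in> borel_measurable P" unfolding h_def using f by measurable
      show "0 \<le> h x" for x using f0 by (simp add: h_def)
      show "h x \<le> K / 2 ^ s" for x using fK by (simp add: h_def divide_right_mono)
      fix j assume j: "j \<in> S' s"
      then have jS: "j \<in> S" by (simp add: S'_def)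
      have "ennreal ((1 / 2) ^ s) * (ennreal (2 ^ s) * emeasure P (rect (Q j))) \<le> ennreal ((1 / 2) ^ s) * g j"
        using j by (intro mult_left_mono) (auto simp: S'_def)
      then show "emeasure P (rect (Q j)) \<le> (\<integral>\<^sup>+x\<in>rect (Q j). ennreal (h x) \<partial>P)"
        unfolding hint[OF jS] pw .
      have "ennreal ((1 / 2) ^ s) * g j \<le> ennreal ((1 / 2) ^ s) * (ennreal (2 ^ Suc s) * emeasure P (rect (Q j)))"
        using j by (intro mult_left_mono) (auto simp: S'_def)
      then show "(\<integral>\<^sup>+x\<in>rect (Q j). ennreal (h x) \<partial>P) \<le> 2 * emeasure P (rect (Q j))"
        unfolding hint[OF jS] pw .
    qed
    have "(\<integral>\<^sup>+x. ennreal (h x * ln (exp 1 + h x) ^ (m - 2)) \<partial>P) \<le> (\<integral>\<^sup>+x. ennreal ((1 / 2) ^ s) * ennreal (f x * ln (exp 1 + f x) ^ (m - 2)) \<partial>P)"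
    proof (rule nn_integral_mono)
      fix x
      have hf: "0 \<le> h x" "h x \<le> f x"
        using f0[of x] by (auto simp: h_def divide_le_eq mult_le_cancel_left1 intro: order_trans[OF _ mult_left_mono[of 1]])
      have e1: "exp 1 \<ge> (1::real)" by simp
      \<comment> \<open>The logarithm of \<open>h\<close> does not exceed that of \<open>f\<close>,
        so the linear factor alone supplies the gain \<open>(1 / 2) ^ s\<close>.\<close>
      have "ln (exp 1 + h x) ^ (m - 2) \<le> ln (exp 1 + f x) ^ (m - 2)"
      proof (rule power_mono)
        show "ln (exp 1 + h x) \<le> ln (exp 1 + f x)" using hf by (intro ln_mono) (auto intro: add_pos_nonneg)
        show "0 \<le> ln (exp 1 + h x)" using hf e1 by (intro ln_ge_zero) linarith
      qed
      then have "h x * ln (exp 1 + h x) ^ (m - 2) \<le> h x * ln (exp 1 + f x) ^ (m - 2)"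
        using hf by (intro mult_left_mono)
      also have "\<dots> = (1 / 2) ^ s * (f x * ln (exp 1 + f x) ^ (m - 2))"
        by (simp add: h_def power_divide)
      finally show "ennreal (h x * ln (exp 1 + h x) ^ (m - 2)) \<le> ennreal ((1 / 2) ^ s) * ennreal (f x * ln (exp 1 + f x) ^ (m - 2))"
        by (subst ennreal_mult'[symmetric]) (auto intro: ennreal_leI)
    qed
    also have "\<dots> = ennreal ((1 / 2) ^ s) * I"
      unfolding I_def by (intro nn_integral_cmult borel_measurable_mult_ln_power f)
    finally have "(\<integral>\<^sup>+x. ennreal (h x * ln (exp 1 + h x) ^ (m - 2)) \<partial>P) \<le> ennreal ((1 / 2) ^ s) * I" .
    from order_trans[OF union mult_left_mono[OF this]] show ?thesis by simp
  qed
  have "emeasure P (\<Union>j\<in>S. rect (Q j)) \<le> emeasure P (\<Union>s\<in>{..<Suc n}. \<Union>j\<in>S' s. rect (Q j))"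
  proof (rule emeasure_mono)
    show "(\<Union>j\<in>S. rect (Q j)) \<subseteq> (\<Union>s\<in>{..<Suc n}. \<Union>j\<in>S' s. rect (Q j))" using cover by fastforce
    show "(\<Union>s\<in>{..<Suc n}. \<Union>j\<in>S' s. rect (Q j)) \<in> sets P"
      using rs fin by (intro sets.finite_UN) (auto simp: S'_def)
  qed
  also have "\<dots> \<le> (\<Sum>s\<in>{..<Suc n}. emeasure P (\<Union>j\<in>S' s. rect (Q j)))"
    using rs fin by (intro emeasure_subadditive_finite) (auto simp: S'_def intro!: sets.finite_UN)
  also have "\<dots> \<le> (\<Sum>s\<in>{..<Suc n}. ennreal ((1 / 2) ^ s) * (ennreal (bound_const m) * I))"
    using level by (intro sum_mono) (simp only: mult_ac)
  also have "\<dots> = ennreal (\<Sum>s<Suc n. (1 / 2) ^ s) * (ennreal (bound_const m) * I)"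
    by (simp only: sum_distrib_right[symmetric] sum_ennreal zero_le_power zero_le_divide_1_iff zero_le_numeral)
  also have "\<dots> \<le> ennreal 2 * (ennreal (bound_const m) * I)"
  proof (intro mult_right_mono ennreal_leI)
    have "(\<Sum>s<Suc n. (1 / 2) ^ s) \<le> (\<Sum>s. (1 / 2) ^ s :: real)"
      by (intro sum_le_suminf) (auto intro: summable_geometric)
    also have "\<dots> = 2" by (subst suminf_geometric) auto
    finally show "(\<Sum>s<Suc n. (1 / 2) ^ s) \<le> (2::real)" .
  qed simp
  also have "\<dots> = ennreal (2 * bound_const m) * I"
    by (simp only: ennreal_mult'[of 2] zero_le_numeral mult.assoc)
  finally show ?thesis unfolding I_def .
qed

end

subsection \<open>Dyadic rectangles\<close>

text \<open>
  The end points of the coarser grid belong to the finer one, because \<open>(-2)\<^sup>d - 1\<close> is divisible by 3.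
\<close>

lemma shift_diff_Ints:
  fixes a :: real
  assumes "a \<in> {0, 1 / 3, 2 / 3}" "k \<le> k'"
  shows "\<exists>N::int. 2 powi k' * (of_int z' + (-1) powi k' * a) - 2 powi k * (of_int z + (-1) powi k * a) = 2 powi k * of_int N"
proof -
  obtain t :: int where t: "a = of_int t / 3"
  proof -
    have "a = of_int 0 / 3 \<or> a = of_int 1 / 3 \<or> a = of_int 2 / 3" using assms(1) by auto
    then show ?thesis using that by blast
  qed
  obtain d :: nat where d: "k' = k + int d" using assms(2) zle_iff_zadd by blast
  obtain s :: int where s: "(-1::real) powi k = of_int s"
  proof -
    have "(-1::real) powi k = of_int 1 \<or> (-1::real) powi k = of_int (-1)"
      by (cases "even k") (auto simp: power_int_minus_left)
    then show ?thesis using that by blast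
  qed
  have "\<exists>e::int. (- 2) ^ d = 1 + 3 * e"
  proof (induction d)
    case (Suc d)
    then obtain e :: int where "(- 2) ^ d = 1 + 3 * e" by blast
    then have "(- 2) ^ Suc d = 1 + 3 * (- 1 - 2 * e)" by (simp only: power_Suc) simp
    then show ?case by blast
  qed simp
  then obtain e :: int where e: "(- 2) ^ d = 1 + 3 * e" by blast
  have eR: "(- 1) ^ d * 2 ^ d = (1 + 3 * of_int e :: real)"
  proof -
    have "(- 1) ^ d * 2 ^ d = ((- 1) * 2 :: real) ^ d" by (simp only: power_mult_distrib)
    also have "\<dots> = of_int ((- 2) ^ d)" by simp
    also have "\<dots> = 1 + 3 * of_int e" unfolding e by simp
    finally show ?thesis .
  qed
  have p: "(2::real) powi k' = 2 powi k * 2 ^ d" "(-1::real) powi k' = of_int s * (-1) ^ d"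
    unfolding d by (simp_all add: power_int_add s)
  have "A * B * (Z' + S * E * a) - A * (Z + S * a) = A * (B * Z' - Z + S * a * (E * B - 1))"
    for A B E S Z Z' :: real by (simp add: algebra_simps)
  then have "2 powi k' * (of_int z' + (-1) powi k' * a) - 2 powi k * (of_int z + (-1) powi k * a)
      = 2 powi k * (2 ^ d * of_int z' - of_int z + of_int s * a * ((- 1) ^ d * 2 ^ d - 1))"
    unfolding p s .
  also have "2 ^ d * of_int z' - of_int z + of_int s * a * ((- 1) ^ d * 2 ^ d - 1) = real_of_int (2 ^ d * z' - z + s * t * e)"
    unfolding eR t by simp
  finally show ?thesis by blast
qed

text \<open>The left ends differ by \<open>N\<close> fine lengths. A common point gives
  \<open>N < 1\<close> and \<open>N + 2 ^ d > 0\<close>; integrality sharpens this to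
  \<open>N \<le> 0\<close> and \<open>N + 2 ^ d \<ge> 1\<close>, which is the inclusion.\<close>

lemma dyadic_interval_nested:
  fixes p p' x y :: real
  assumes diff: "p' - p = 2 powi k * of_int N" and k: "k \<le> k'"
    and x: "x \<in> {p..<p + 2 powi k}" "x \<in> {p'..<p' + 2 powi k'}" and y: "y \<in> {p..<p + 2 powi k}"
  shows "y \<in> {p'..<p' + 2 powi k'}"
proof -
  obtain d :: nat where d: "k' = k + int d" using k zle_iff_zadd by blast
  define u where "u = (2::real) powi k"
  have u: "u > 0" by (simp add: u_def)
  have k': "(2::real) powi k' = u * of_int (2 ^ d)" unfolding d u_def by (simp add: power_int_add)
  have p': "p' = p + u * of_int N" using diff by (simp add: u_def)
  have x1: "p \<le> x" "x < p + u" using x(1) by (auto simp: u_def)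
  have x2: "p' \<le> x" "x < p' + u * of_int (2 ^ d)" using x(2) unfolding k' by auto
  have "u * of_int N < u * 1" using x1 x2 p' by linarith
  then have "of_int N < (1::real)" using u by (simp only: mult_less_cancel_left_pos)
  then have N0: "N \<le> 0" by simp
  have "u * 0 < u * (of_int N + of_int (2 ^ d))"
    using x1 x2 p' unfolding distrib_left by linarith
  then have "(0::real) < of_int N + of_int (2 ^ d)" using u by (simp only: mult_less_cancel_left_pos)
  then have N1: "1 \<le> N + 2 ^ d" by linarith
  have "u * of_int N \<le> u * 0" using u N0 by (intro mult_left_mono) auto
  moreover have "u * 1 \<le> u * of_int (N + 2 ^ d)"
    using u N1 by (intro mult_left_mono) linarith+
  moreover have "p \<le> y" "y < p + u" using y by (auto simp: u_def)
  ultimately have "p' \<le> y" "y < p' + u * of_int (2 ^ d)" using p' by (simp_all add: distrib_left)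
  then show ?thesis unfolding k' by simp
qed

lemma dyadic_cube_nested:
  assumes a: "\<And>j. j \<in> {1..n} \<Longrightarrow> a j \<in> {0, 1 / 3, 2 / 3}" and k: "k \<le> k'"
    and ne: "dyadic_cube n a k z \<inter> dyadic_cube n a k' z' \<noteq> {}"
  shows "dyadic_cube n a k z \<subseteq> dyadic_cube n a k' z'"
proof
  obtain x where x: "x \<in> dyadic_cube n a k z" "x \<in> dyadic_cube n a k' z'" using ne by blast
  fix y assume y: "y \<in> dyadic_cube n a k z"
  have "y j \<in> {2 powi k' * (of_int (z' j) + (-1) powi k' * a j)..<
      2 powi k' * (of_int (z' j) + (-1) powi k' * a j) + 2 powi k'}" if j: "j \<in> {1..n}" for j
  proof -
    obtain N :: int where N: "2 powi k' * (of_int (z' j) + (-1) powi k' * a j)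
        - 2 powi k * (of_int (z j) + (-1) powi k * a j) = 2 powi k * of_int N"
      using shift_diff_Ints[OF a[OF j] k, where z = "z j" and z' = "z' j"] by blast
    show ?thesis
      by (rule dyadic_interval_nested[OF N k PiE_mem[OF x(1)[unfolded dyadic_cube_eq] j]
            PiE_mem[OF x(2)[unfolded dyadic_cube_eq] j] PiE_mem[OF y[unfolded dyadic_cube_eq] j]])
  qed
  then show "y \<in> dyadic_cube n a k' z'"
    using PiE_arb[OF y[unfolded dyadic_cube_eq]] unfolding dyadic_cube_eq by (intro PiE_I)
qed

lemma product_sigma_finite_lborel:
  fixes d :: "nat \<Rightarrow> nat"
  shows "product_sigma_finite (\<lambda>i. \<Pi>\<^sub>M j\<in>{1..d i}. (lborel :: real measure))"
proof (rule product_sigma_finite.intro)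
  fix i
  interpret L: product_sigma_finite "\<lambda>j::nat. lborel :: real measure" by standard
  show "sigma_finite_measure (\<Pi>\<^sub>M j\<in>{1..d i}. (lborel :: real measure))" by (rule L.sigma_finite) simp
qed

lemma dyadic_cube_sets: "dyadic_cube n a k z \<in> sets (\<Pi>\<^sub>M j\<in>{1..n}. lborel)"
  unfolding dyadic_cube_eq by (intro sets_PiM_I_finite) auto

lemma emeasure_dyadic_cube: "emeasure (\<Pi>\<^sub>M j\<in>{1..n}. lborel) (dyadic_cube n a k z) = ennreal ((2 powi k) ^ n)"
proof -
  interpret L: product_sigma_finite "\<lambda>j::nat. lborel :: real measure" by standard
  show ?thesis unfolding dyadic_cube_eq by (subst L.emeasure_PiM) (auto simp: prod_ennreal ennreal_power)
qed

section \<open>Rounded scales and the order of the rectangles\<close>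

lemma rho_mono: "0 < s \<Longrightarrow> s \<le> t \<Longrightarrow> rho s \<le> rho t"
  unfolding rho_def by (intro add_right_mono ceiling_mono) (simp add: log_mono)

text \<open>Replaces side lengths by the exponents of the cubes, together with a parameter
  \<open>s\<close> producing them; later only exponents are compared.\<close>

lemma rect_familyD:
  assumes R: "R \<in> rect_family m d \<phi> \<tau>" and d: "\<And>i. i \<in> {1..m} \<Longrightarrow> d i \<ge> 1" and m: "m \<ge> 1"
  shows "\<exists>k z s. R = (\<Pi>\<^sub>E i\<in>{1..m}. dyadic_cube (d i) (\<tau> i) (k i) (z i)) \<and>
    s \<in> pos_orthant (m - 1) \<and> (\<forall>i\<in>{1..m - 1}. k i = rho (s i)) \<and> k m = rho (\<phi> s)"
proof -
  obtain Q where RQ: "R = (\<Pi>\<^sub>E i\<in>{1..m}. Q i)" and Q: "\<forall>i\<in>{1..m}. Q i \<in> dyadic_grid (d i) (\<tau> i)"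
    and G: "(\<lambda>i\<in>{1..m}. log 2 (side_length (d i) (Q i))) \<in> Gamma_set m \<phi>"
    using R unfolding rect_family_def by blast
  have "\<forall>i\<in>{1..m}. \<exists>kz. Q i = dyadic_cube (d i) (\<tau> i) (fst kz) (snd kz)"
    using Q unfolding dyadic_grid_def by fastforce
  then obtain kz where kz: "\<And>i. i \<in> {1..m} \<Longrightarrow> Q i = dyadic_cube (d i) (\<tau> i) (fst (kz i)) (snd (kz i))"
    by metis
  obtain s where s: "s \<in> pos_orthant (m - 1)"
    and eq: "(\<lambda>i\<in>{1..m}. log 2 (side_length (d i) (Q i))) = (\<lambda>i\<in>{1..m}. of_int (if i = m then rho (\<phi> s) else rho (s i)))"
    using G unfolding Gamma_set_def by blast
  \<comment> \<open>In dimension at least 1 the cube determines its side length, so the exponent can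
    be read off through \<open>log 2\<close>.\<close>
  have k: "fst (kz i) = (if i = m then rho (\<phi> s) else rho (s i))" if i: "i \<in> {1..m}" for i
  proof -
    have "log 2 (2 powi fst (kz i)) = real_of_int (if i = m then rho (\<phi> s) else rho (s i))"
      using fun_cong[OF eq, of i] i kz[OF i] side_length_dyadic_cube[OF d[OF i]] by simp
    moreover have "log 2 (2 powi fst (kz i)) = real_of_int (fst (kz i))"
    proof -
      have "(2::real) powi fst (kz i) = 2 powr real_of_int (fst (kz i))" by (simp add: powr_real_of_int')
      then show ?thesis by (simp only: log_powr_cancel zero_less_numeral numeral_eq_one_iff semiring_norm num.distinct simp_thms)
    qed
    ultimately show ?thesis by (simp only: of_int_eq_iff)
  qed
  show ?thesis
  proof (intro exI[of _ "\<lambda>i. fst (kz i)"] exI[of _ "\<lambda>i. snd (kz i)"] exI[of _ s] conjI ballI)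
    show "R = (\<Pi>\<^sub>E i\<in>{1..m}. dyadic_cube (d i) (\<tau> i) (fst (kz i)) (snd (kz i)))"
      unfolding RQ using kz by (intro PiE_cong) auto
    show "s \<in> pos_orthant (m - 1)" by fact
    show "fst (kz i) = rho (s i)" if "i \<in> {1..m - 1}" for i using k[of i] that by auto
    show "fst (kz m) = rho (\<phi> s)" using k[of m] m by auto
  qed
qed

text \<open>If every scale of \<open>k'\<close> below \<open>m\<close> were strictly larger,
  monotonicity of \<open>rho\<close> would give \<open>s i \<le> s' i\<close> throughout. Then
  \<open>\<phi>\<close> would force \<open>k m \<le> k' m\<close>, hence a tie, and the tie-break on
  the sums would fail.\<close>

lemma exists_scale_le:
  fixes k k' :: "nat \<Rightarrow> int"
  assumes m: "m \<ge> 2" and \<phi>: "\<phi> \<in> pos_orthant (m - 1) \<rightarrow> {0<..}" "coordwise_nondecreasing (m - 1) \<phi>"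
    and s: "s \<in> pos_orthant (m - 1)" "\<And>i. i \<in> {1..m - 1} \<Longrightarrow> k i = rho (s i)" "k m = rho (\<phi> s)"
    and s': "s' \<in> pos_orthant (m - 1)" "\<And>i. i \<in> {1..m - 1} \<Longrightarrow> k' i = rho (s' i)" "k' m = rho (\<phi> s')"
    and ge: "k' m \<le> k m" and sum: "k m = k' m \<Longrightarrow> (\<Sum>i=1..m - 1. k' i) \<le> (\<Sum>i=1..m - 1. k i)"
  shows "\<exists>i\<in>{1..m - 1}. k' i \<le> k i"
proof (rule ccontr)
  assume "\<not> ?thesis"
  then have less: "k i < k' i" if "i \<in> {1..m - 1}" for i using that by force
  have "s i \<le> s' i" if i: "i \<in> {1..m - 1}" for i
  proof (rule ccontr)
    assume "\<not> s i \<le> s' i"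
    moreover have "0 < s' i" using s'(1) i by (auto simp: pos_orthant_def PiE_iff)
    ultimately have "rho (s' i) \<le> rho (s i)" by (intro rho_mono) auto
    then show False using less[OF i] s(2)[OF i] s'(2)[OF i] by simp
  qed
  then have "\<phi> s \<le> \<phi> s'" using \<phi>(2) s(1) s'(1) unfolding coordwise_nondecreasing_def by blast
  moreover have "0 < \<phi> s" using \<phi>(1) s(1) by auto
  ultimately have "k m \<le> k' m" unfolding s(3) s'(3) by (intro rho_mono)
  then have "(\<Sum>i=1..m - 1. k' i) \<le> (\<Sum>i=1..m - 1. k i)" using ge sum by simp
  moreover have "(\<Sum>i=1..m - 1. k i) < (\<Sum>i=1..m - 1. k' i)"
    using m less by (intro sum_strict_mono) auto
  ultimately show False by simp
qed

text \<open>Sorting produces the order required by \<open>family_bound\<close>: the earlier of two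
  meeting rectangles has at least the \<open>m\<close>-th scale of the later one,
  \<open>exists_scale_le\<close> supplies the further direction, and meeting dyadic cubes with
  ordered exponents are nested.\<close>

lemma finite_rect_family_bound:
  fixes h :: "(nat \<Rightarrow> nat \<Rightarrow> real) \<Rightarrow> real"
  defines "P \<equiv> \<lambda>m d. \<Pi>\<^sub>M i\<in>{1..m}. \<Pi>\<^sub>M j\<in>{1..d i}. (lborel :: real measure)"
  assumes m: "m \<ge> 2" and d: "\<And>i. i \<in> {1..m} \<Longrightarrow> d i \<ge> 1"
    and \<phi>: "\<phi> \<in> pos_orthant (m - 1) \<rightarrow> {0<..}" "coordwise_nondecreasing (m - 1) \<phi>"
    and \<tau>: "\<And>i j. i \<in> {1..m} \<Longrightarrow> j \<in> {1..d i} \<Longrightarrow> \<tau> i j \<in> {0, 1 / 3, 2 / 3}"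
    and fin: "finite \<F>" and \<F>: "\<F> \<subseteq> rect_family m d \<phi> \<tau>"
    and h: "h \<in> borel_measurable (P m d)" and h0: "\<And>x. 0 \<le> h x" and hK: "\<And>x. h x \<le> K"
    and avg: "\<And>R. R \<in> \<F> \<Longrightarrow> emeasure (P m d) R \<le> (\<integral>\<^sup>+x\<in>R. ennreal (h x) \<partial>P m d)"
  shows "emeasure (P m d) (\<Union>\<F>)
    \<le> ennreal (2 * bound_const m) * (\<integral>\<^sup>+x. ennreal (h x * ln (exp 1 + h x) ^ (m - 2)) \<partial>P m d)"
proof -
  let ?M = "\<lambda>i. \<Pi>\<^sub>M j\<in>{1..d i}. (lborel :: real measure)"
  interpret finite_product ?M m
    by (rule finite_product.intro[OF product_sigma_finite_lborel])
  have "\<forall>R\<in>\<F>. \<exists>k z s. R = (\<Pi>\<^sub>E i\<in>{1..m}. dyadic_cube (d i) (\<tau> i) (k i) (z i)) \<and>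
    s \<in> pos_orthant (m - 1) \<and> (\<forall>i\<in>{1..m - 1}. k i = rho (s i)) \<and> k m = rho (\<phi> s)"
    using \<F> m by (intro ballI rect_familyD d) auto
  from bchoice[OF this] obtain k where "\<forall>R\<in>\<F>. \<exists>z s. R = (\<Pi>\<^sub>E i\<in>{1..m}. dyadic_cube (d i) (\<tau> i) (k R i) (z i)) \<and>
    s \<in> pos_orthant (m - 1) \<and> (\<forall>i\<in>{1..m - 1}. k R i = rho (s i)) \<and> k R m = rho (\<phi> s)" by (rule exE)
  from bchoice[OF this] obtain z where "\<forall>R\<in>\<F>. \<exists>s. R = (\<Pi>\<^sub>E i\<in>{1..m}. dyadic_cube (d i) (\<tau> i) (k R i) (z R i)) \<and>
    s \<in> pos_orthant (m - 1) \<and> (\<forall>i\<in>{1..m - 1}. k R i = rho (s i)) \<and> k R m = rho (\<phi> s)" by (rule exE)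
  from bchoice[OF this] obtain s where kzs_all: "\<forall>R\<in>\<F>. R = (\<Pi>\<^sub>E i\<in>{1..m}. dyadic_cube (d i) (\<tau> i) (k R i) (z R i)) \<and>
    s R \<in> pos_orthant (m - 1) \<and> (\<forall>i\<in>{1..m - 1}. k R i = rho (s R i)) \<and> k R m = rho (\<phi> (s R))" by (rule exE)
  note kzs = bspec[OF kzs_all]
  define \<Sigma> where "\<Sigma> R = (\<Sum>i=1..m - 1. k R i)" for R
  define B where "B = 1 + 2 * (\<Sum>R\<in>\<F>. \<bar>\<Sigma> R\<bar>)"
  have \<Sigma>B: "2 * \<bar>\<Sigma> R\<bar> < B" if "R \<in> \<F>" for R
    using member_le_sum[of R \<F> "\<lambda>R. \<bar>\<Sigma> R\<bar>"] that fin by (simp add: B_def)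
  \<comment> \<open>\<open>B\<close> is so large that sorting by \<open>key\<close> is lexicographic in \<open>k R m\<close> and \<open>\<Sigma> R\<close>\<close>
  define key where "key R = - (k R m * B + \<Sigma> R)" for R
  obtain xs where xs: "set xs = \<F>" using finite_list[OF fin] by blast
  define ys where "ys = sort_key key xs"
  have ys: "set ys = \<F>" by (simp add: ys_def xs)
  have ysF: "ys ! j \<in> \<F>" if "j < length ys" for j using nth_mem[OF that] ys by simp
  define Q where "Q j i = dyadic_cube (d i) (\<tau> i) (k (ys ! j) i) (z (ys ! j) i)" for j i
  have rectQ: "rect (Q j) = ys ! j" if "j \<in> {..<length ys}" for j
    using kzs[OF ysF, of j] that unfolding rect_def Q_def by simp
  have Qne: "Q j i \<inter> Q l i \<noteq> {}" if "rect (Q l) \<inter> rect (Q j) \<noteq> {}" "i \<in> {1..m}" for l j i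
    using that(1) rect_mem[OF _ that(2)] by blast
  have nest: "Q j i \<subseteq> Q l i" if "k (ys ! j) i \<le> k (ys ! l) i" "Q j i \<inter> Q l i \<noteq> {}" "i \<in> {1..m}" for j l i
    using that(1,2) unfolding Q_def by (intro dyadic_cube_nested \<tau>[OF that(3)])
  have UF: "\<Union>\<F> = (\<Union>j\<in>{..<length ys}. rect (Q j))"
  proof -
    have "\<F> = (\<lambda>j. ys ! j) ` {..<length ys}" unfolding ys[symmetric] by (auto simp: set_conv_nth)
    then show ?thesis using rectQ by simp
  qed
  show ?thesis
    unfolding UF P_def
  proof (rule family_bound[OF m finite_lessThan, where K = K])
    fix j i assume j: "j \<in> {..<length ys}" and i: "i \<in> {1..m}"
    show "Q j i \<in> sets (?M i)" unfolding Q_def by (rule dyadic_cube_sets)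
    show "0 < emeasure (?M i) (Q j i)" "emeasure (?M i) (Q j i) < \<infinity>"
      unfolding Q_def emeasure_dyadic_cube by simp_all
  next
    fix l j i assume "i \<in> {1..m}"
    then show "Q l i \<inter> Q j i = {} \<or> Q l i \<subseteq> Q j i \<or> Q j i \<subseteq> Q l i"
      using nest[of l i j] nest[of j i l] by (metis Int_commute linear)
  next
    fix l j assume l: "l \<in> {..<length ys}" and j: "j \<in> {..<length ys}" and lj: "l < j"
      and ne: "rect (Q l) \<inter> rect (Q j) \<noteq> {}"
    let ?R = "ys ! l" and ?R' = "ys ! j"
    have R: "?R \<in> \<F>" "?R' \<in> \<F>" using l j ysF by auto
    have "sorted (map key ys)" by (simp add: ys_def)
    then have "key ?R \<le> key ?R'" using lj j sorted_nth_mono[of "map key ys" l j] by simp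
    then have key: "k ?R' m * B + \<Sigma> ?R' \<le> k ?R m * B + \<Sigma> ?R" by (simp add: key_def)
    \<comment> \<open>One unit of \<open>k R m\<close> weighs \<open>B\<close> in the key, more than
      the difference of two values of \<open>\<Sigma>\<close>.\<close>
    have ge: "k ?R' m \<le> k ?R m"
    proof (rule ccontr)
      assume "\<not> ?thesis"
      then have "(k ?R m + 1) * B \<le> k ?R' m * B" using \<Sigma>B[OF R(1)] by (intro mult_right_mono) auto
      then show False using key \<Sigma>B[OF R(1)] \<Sigma>B[OF R(2)] by (simp add: distrib_right)
    qed
    have "\<exists>i\<in>{1..m - 1}. k ?R' i \<le> k ?R i"
    proof (rule exists_scale_le[OF m \<phi>])
      show "k ?R m = k ?R' m \<Longrightarrow> (\<Sum>i=1..m - 1. k ?R' i) \<le> (\<Sum>i=1..m - 1. k ?R i)"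
        using key by (simp add: \<Sigma>_def)
    qed (use kzs[OF R(1)] kzs[OF R(2)] ge in auto)
    then obtain i where i: "i \<in> {1..m - 1}" "k ?R' i \<le> k ?R i" by blast
    have "Q j i \<subseteq> Q l i" using i by (intro nest Qne[OF ne]) auto
    moreover have "Q j m \<subseteq> Q l m" using ge m by (intro nest Qne[OF ne]) auto
    ultimately show "Q j m \<subseteq> Q l m \<and> (\<exists>i\<in>{1..m - 1}. Q j i \<subseteq> Q l i)" using i(1) by blast
  next
    show "h \<in> borel_measurable (Pi\<^sub>M {1..m} ?M)" using h by (simp add: P_def)
    fix j assume j: "j \<in> {..<length ys}"
    have "ys ! j \<in> \<F>" using j ysF by auto
    from avg[OF this] show "emeasure (Pi\<^sub>M {1..m} ?M) (rect (Q j)) \<le> (\<integral>\<^sup>+x\<in>rect (Q j). ennreal (h x) \<partial>Pi\<^sub>M {1..m} ?M)"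
      by (simp only: rectQ[OF j] P_def)
  qed (use h0 hK in auto)
qed

section \<open>From finite families to the level set\<close>

lemma emeasure_countable_Union_le:
  assumes \<E>: "countable \<E>" "\<E> \<subseteq> sets N"
    and le: "\<And>\<F>. finite \<F> \<Longrightarrow> \<F> \<subseteq> \<E> \<Longrightarrow> emeasure N (\<Union>\<F>) \<le> c"
  shows "emeasure N (\<Union>\<E>) \<le> c"
proof (cases "\<E> = {}")
  case True then show ?thesis by simp
next
  case False
  \<comment> \<open>Finite unions along an enumeration increase to the whole union, so continuity
    from below carries the bound over.\<close>
  define A where "A n = \<Union>(from_nat_into \<E> ` {..n})" for n
  have sub: "from_nat_into \<E> ` {..n} \<subseteq> \<E>" for n using from_nat_into[OF False] by auto
  have A: "range A \<subseteq> sets N" unfolding A_def using sub \<E>(2) by (auto intro!: sets.finite_Union)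
  have "incseq A" unfolding A_def by (intro monoI Union_mono image_mono) auto
  moreover have "\<Union>\<E> = (\<Union>n. A n)"
  proof -
    have "\<Union>(range (from_nat_into \<E>)) = (\<Union>n. A n)" unfolding A_def by auto
    then show ?thesis by (simp only: range_from_nat_into[OF False \<E>(1)])
  qed
  ultimately have "emeasure N (\<Union>\<E>) = (SUP n. emeasure N (A n))"
    using SUP_emeasure_incseq[OF A] by simp
  also have "\<dots> \<le> c" unfolding A_def using le sub by (intro SUP_least) auto
  finally show ?thesis .
qed

theorem theorem6p5:
  fixes m d :: nat
  assumes "m \<ge> 3"
  shows "\<exists>C::real. C > 0 \<and>
    (\<forall>(ds::nat \<Rightarrow> nat) (\<phi>::(nat \<Rightarrow> real) \<Rightarrow> real) (\<tau>::nat \<Rightarrow> nat \<Rightarrow> real)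
        (f::(nat \<Rightarrow> nat \<Rightarrow> real) \<Rightarrow> real) (lam::real).
       (\<forall>i\<in>{1..m}. ds i \<ge> 1) \<longrightarrow>
       (\<Sum>i=1..m. ds i) = d \<longrightarrow>
       \<phi> \<in> pos_orthant (m - 1) \<rightarrow> {0<..} \<longrightarrow>
       coordwise_nondecreasing (m - 1) \<phi> \<longrightarrow>
       (\<forall>i\<in>{1..m}. \<forall>j\<in>{1..ds i}. \<tau> i j \<in> {0, 1/3, 2/3}) \<longrightarrow>
       locally_integrable m ds f \<longrightarrow>
       lam > 0 \<longrightarrow>
       emeasure (leb m ds)
         {x \<in> space (leb m ds).
            maximal_fun (leb m ds) (rect_family m ds \<phi> \<tau>) f x > ennreal lam}
       \<le> ennreal C *
         (\<integral>\<^sup>+x. ennreal (\<bar>f x\<bar> / lam * (ln (exp 1 + \<bar>f x\<bar> / lam)) ^ (m - 2)) \<partial>(leb m ds)))"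
proof (intro exI[of _ "2 * bound_const m"] conjI allI impI)
  have "selection_ratio m > 0"
    using assms by (simp add: selection_ratio_def)
  then show "0 < 2 * bound_const m" by (simp add: bound_const_def)
next
  fix ds :: "nat \<Rightarrow> nat" and \<phi> :: "(nat \<Rightarrow> real) \<Rightarrow> real" and \<tau> :: "nat \<Rightarrow> nat \<Rightarrow> real"
    and f :: "(nat \<Rightarrow> nat \<Rightarrow> real) \<Rightarrow> real" and lam :: real
  assume ds: "\<forall>i\<in>{1..m}. ds i \<ge> 1" and \<phi>: "\<phi> \<in> pos_orthant (m - 1) \<rightarrow> {0<..}" "coordwise_nondecreasing (m - 1) \<phi>"
    and \<tau>: "\<forall>i\<in>{1..m}. \<forall>j\<in>{1..ds i}. \<tau> i j \<in> {0, 1/3, 2/3}"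
    and f: "locally_integrable m ds f" and lam: "lam > 0"
  let ?C = "2 * bound_const m"
  define P where "P = (\<Pi>\<^sub>M i\<in>{1..m}. \<Pi>\<^sub>M j\<in>{1..ds i}. (lborel :: real measure))"
  have leb: "leb m ds = completion P" by (simp add: leb_def P_def)
  have "f \<in> borel_measurable (completion P)" using f by (simp add: locally_integrable_def leb)
  \<comment> \<open>\<open>f\<close> is measurable only for the completion. A version
    \<open>g\<close> equal to it almost everywhere is measurable for the product measure itself and
    leaves all integrals unchanged.\<close>
  then obtain g where g: "g \<in> borel_measurable P" and fg: "AE x in P. f x = g x"
    using completion_ex_borel_measurable_real by blast
  define h where "h x = \<bar>g x\<bar> / lam" for x
  have h: "h \<in> borel_measurable P" unfolding h_def using g by measurable
  have h0: "0 \<le> h x" for x using lam by (simp add: h_def)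
  define \<Psi> where "\<Psi> y = y * ln (exp 1 + y) ^ (m - 2)" for y :: real
  define I where "I = (\<integral>\<^sup>+x. ennreal (\<Psi> (h x)) \<partial>P)"
  have I: "(\<integral>\<^sup>+x. ennreal (\<bar>f x\<bar> / lam * (ln (exp 1 + \<bar>f x\<bar> / lam)) ^ (m - 2)) \<partial>(leb m ds)) = I"
    unfolding leb nn_integral_completion I_def
    by (rule nn_integral_cong_AE) (use fg in \<open>auto simp: h_def \<Psi>_def elim: eventually_mono\<close>)
  \<comment> \<open>A supremum exceeds \<open>lam\<close> exactly when one of the averages does, so
    these rectangles make up the level set.\<close>
  define \<E> where "\<E> = {R \<in> rect_family m ds \<phi> \<tau>.
    ennreal lam < (\<integral>\<^sup>+y\<in>R. ennreal \<bar>f y\<bar> \<partial>leb m ds) / emeasure (leb m ds) R}"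
  have E_rect: "\<E> \<subseteq> rect_family m ds \<phi> \<tau>" by (auto simp: \<E>_def)
  have R_P: "R \<in> sets P \<and> emeasure P R < \<infinity>" if RF: "R \<in> rect_family m ds \<phi> \<tau>" for R
  proof -
    have "m \<ge> 1" using assms by simp
    then obtain k z where R: "R = (\<Pi>\<^sub>E i\<in>{1..m}. dyadic_cube (ds i) (\<tau> i) (k i) (z i))"
      using rect_familyD[OF RF] ds by meson
    interpret product_sigma_finite "\<lambda>i. \<Pi>\<^sub>M j\<in>{1..ds i}. (lborel :: real measure)"
      by (rule product_sigma_finite_lborel)
    have "R \<in> sets P" unfolding R P_def by (intro sets_PiM_I_finite dyadic_cube_sets) auto
    moreover have "emeasure P R = (\<Prod>i\<in>{1..m}. ennreal ((2 powi k i) ^ ds i))"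
      unfolding R P_def by (subst emeasure_PiM) (auto simp: dyadic_cube_sets emeasure_dyadic_cube)
    moreover have "\<dots> < \<infinity>" by (subst prod_ennreal) auto
    ultimately show ?thesis by simp
  qed
  have E_avg: "emeasure P R < (\<integral>\<^sup>+x\<in>R. ennreal (h x) \<partial>P)" if R: "R \<in> \<E>" for R
  proof -
    have Rs: "R \<in> sets P" "emeasure P R < top" using R_P[of R] R E_rect by auto
    have "emeasure (leb m ds) R = emeasure P R"
      using Rs(1) unfolding leb by (simp add: sets_completionI_sets main_part_sets)
    moreover have "(\<integral>\<^sup>+y\<in>R. ennreal \<bar>f y\<bar> \<partial>leb m ds) = (\<integral>\<^sup>+y. ennreal lam * (ennreal (h y) * indicator R y) \<partial>P)"
      unfolding leb nn_integral_completion
    proof (rule nn_integral_cong_AE)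
      show "AE x in P. ennreal \<bar>f x\<bar> * indicator R x = ennreal lam * (ennreal (h x) * indicator R x)"
        using fg
      proof (eventually_elim)
        case (elim x)
        have "ennreal lam * ennreal (h x) = ennreal \<bar>f x\<bar>"
          using lam h0[of x] elim by (simp add: ennreal_mult[symmetric] h_def)
        then show ?case by (simp only: mult.assoc[symmetric])
      qed
    qed
    moreover have "(\<integral>\<^sup>+y. ennreal lam * (ennreal (h y) * indicator R y) \<partial>P) = ennreal lam * (\<integral>\<^sup>+y\<in>R. ennreal (h y) \<partial>P)"
      using Rs(1) by (intro nn_integral_cmult borel_measurable_times_ennreal borel_measurable_indicator
          measurable_compose[OF h measurable_ennreal])
    ultimately have less: "ennreal lam < ennreal lam * (\<integral>\<^sup>+y\<in>R. ennreal (h y) \<partial>P) / emeasure P R"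
      using R by (simp add: \<E>_def)
    show ?thesis
    proof (rule ccontr)
      assume "\<not> ?thesis"
      then have "ennreal lam * (\<integral>\<^sup>+y\<in>R. ennreal (h y) \<partial>P) \<le> ennreal lam * emeasure P R"
        by (intro mult_left_mono) auto
      then have "ennreal lam * (\<integral>\<^sup>+y\<in>R. ennreal (h y) \<partial>P) / emeasure P R \<le> ennreal lam * emeasure P R / emeasure P R"
        by (rule divide_right_mono_ennreal)
      \<comment> \<open>For a null rectangle the quotient is \<open>0 / 0\<close>, which is
        \<open>0\<close> in \<open>ennreal\<close>.\<close>
      also have "\<dots> \<le> ennreal lam"
        using Rs(2) by (cases "emeasure P R = 0") (auto simp: ennreal_mult_divide_eq)
      finally show False using less by simp
    qed
  qed
  have level: "{x \<in> space (leb m ds). maximal_fun (leb m ds) (rect_family m ds \<phi> \<tau>) f x > ennreal lam} = \<Union>\<E>"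
  proof -
    have "x \<in> space (leb m ds)" if "x \<in> R" "R \<in> \<E>" for x R
      using sets.sets_into_space[OF rect_family_sets[of R m ds \<phi> \<tau>]] that E_rect by blast
    then show ?thesis unfolding maximal_fun_def less_SUP_iff \<E>_def by blast
  qed
  have "emeasure P (\<Union>\<E>) \<le> ennreal ?C * I"
  proof (rule emeasure_countable_Union_le)
    show "countable \<E>" by (rule countable_subset[OF E_rect countable_rect_family])
    show "\<E> \<subseteq> sets P" using R_P E_rect by blast
    fix \<F> assume fin: "finite \<F>" and \<F>: "\<F> \<subseteq> \<E>"
    \<comment> \<open>\<open>finite_rect_family_bound\<close> needs a bounded function. By monotone
      convergence the strict inequality in \<open>E_avg\<close> survives truncation at a high enough
      level.\<close>
    have "\<exists>n. emeasure P R < (\<integral>\<^sup>+x\<in>R. ennreal (min (h x) (real n)) \<partial>P)" if "R \<in> \<F>" for R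
    proof -
      have Rs: "R \<in> sets P" using R_P[of R] that \<F> E_rect by blast
      have "(\<integral>\<^sup>+x\<in>R. ennreal (h x) \<partial>P) = (\<integral>\<^sup>+x. (SUP n. ennreal (min (h x) (real n)) * indicator R x) \<partial>P)"
      proof (rule nn_integral_cong)
        fix x
        have "ennreal (h x) = (SUP n. ennreal (min (h x) (real n)))"
        proof (rule antisym)
          obtain n where "h x \<le> real n" using real_arch_simple by blast
          then have "ennreal (h x) = ennreal (min (h x) (real n))" by simp
          also have "\<dots> \<le> (SUP n. ennreal (min (h x) (real n)))" by (rule SUP_upper) simp
          finally show "ennreal (h x) \<le> (SUP n. ennreal (min (h x) (real n)))" .
        qed (auto intro!: SUP_least ennreal_leI)
        then show "ennreal (h x) * indicator R x = (SUP n. ennreal (min (h x) (real n)) * indicator R x)"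
          by (cases "x \<in> R") auto
      qed
      also have "\<dots> = (SUP n. \<integral>\<^sup>+x\<in>R. ennreal (min (h x) (real n)) \<partial>P)"
      proof (rule nn_integral_monotone_convergence_SUP)
        show "incseq (\<lambda>n x. ennreal (min (h x) (real n)) * indicator R x)"
          by (intro monoI le_funI mult_right_mono ennreal_leI min.mono) auto
        show "(\<lambda>x. ennreal (min (h x) (real n)) * indicator R x) \<in> borel_measurable P" for n
          using h Rs by measurable
      qed
      finally have "emeasure P R < (SUP n. \<integral>\<^sup>+x\<in>R. ennreal (min (h x) (real n)) \<partial>P)"
        using E_avg[of R] that \<F> by auto
      then show ?thesis unfolding less_SUP_iff by blast
    qed
    then obtain n where n: "\<And>R. R \<in> \<F> \<Longrightarrow> emeasure P R < (\<integral>\<^sup>+x\<in>R. ennreal (min (h x) (real (n R))) \<partial>P)"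
      by metis
    \<comment> \<open>The sum dominates every \<open>n R\<close> and makes sense for the empty
      family too.\<close>
    define N where "N = real (\<Sum>R\<in>\<F>. n R)"
    have N0: "N \<ge> 0" unfolding N_def by (rule of_nat_0_le_iff)
    define h' where "h' x = min (h x) N" for x
    have "emeasure P (\<Union>\<F>) \<le> ennreal ?C * (\<integral>\<^sup>+x. ennreal (h' x * ln (exp 1 + h' x) ^ (m - 2)) \<partial>P)"
    proof (rule finite_rect_family_bound[where m = m and d = ds and h = h' and K = N, OF _ _ \<phi> _ fin, folded P_def])
      show "\<F> \<subseteq> rect_family m ds \<phi> \<tau>" using \<F> E_rect by blast
      show "h' \<in> borel_measurable P" unfolding h'_def using h by measurable
      fix R assume R: "R \<in> \<F>"
      have "emeasure P R \<le> (\<integral>\<^sup>+x\<in>R. ennreal (min (h x) (real (n R))) \<partial>P)" using n[OF R] by simp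
      also have "\<dots> \<le> (\<integral>\<^sup>+x\<in>R. ennreal (h' x) \<partial>P)"
      proof -
        have "n R \<le> (\<Sum>R\<in>\<F>. n R)" using fin R by (intro member_le_sum) auto
        then have "real (n R) \<le> N" unfolding N_def by (rule of_nat_mono)
        then show ?thesis unfolding h'_def by (intro nn_integral_mono mult_right_mono ennreal_leI min.mono) auto
      qed
      finally show "emeasure P R \<le> (\<integral>\<^sup>+x\<in>R. ennreal (h' x) \<partial>P)" .
    qed (use assms ds \<tau> h0 N0 in \<open>auto simp: h'_def\<close>)
    \<comment> \<open>Truncation only lowers the integrand, since \<open>\<Psi>\<close> increases on
      the nonnegative reals; the bound is therefore uniform in \<open>\<F>\<close> and
      \<open>N\<close>.\<close>
    also have "\<dots> \<le> ennreal ?C * I"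
      unfolding I_def
    proof (intro mult_left_mono nn_integral_mono ennreal_leI)
      fix x
      have h': "0 \<le> h' x" "h' x \<le> h x" using h0 N0 by (auto simp: h'_def)
      have e: "exp 1 > (1::real)" by simp
      have "0 \<le> ln (exp 1 + h' x)" using h' e by (intro ln_ge_zero) linarith
      moreover have "ln (exp 1 + h' x) \<le> ln (exp 1 + h x)" using h' e by (intro ln_mono) linarith+
      ultimately show "h' x * ln (exp 1 + h' x) ^ (m - 2) \<le> \<Psi> (h x)"
        unfolding \<Psi>_def using h' by (intro mult_mono power_mono) auto
    qed simp
    finally show "emeasure P (\<Union>\<F>) \<le> ennreal ?C * I" .
  qed
  moreover have "emeasure (leb m ds) (\<Union>\<E>) = emeasure P (\<Union>\<E>)"
  proof -
    have "\<Union>\<E> \<in> sets P"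
      using R_P E_rect countable_subset[OF E_rect countable_rect_family] by (intro sets.countable_Union) auto
    then show ?thesis unfolding leb by (simp add: sets_completionI_sets main_part_sets)
  qed
  ultimately show "emeasure (leb m ds) {x \<in> space (leb m ds). maximal_fun (leb m ds) (rect_family m ds \<phi> \<tau>) f x > ennreal lam}
     \<le> ennreal ?C * (\<integral>\<^sup>+x. ennreal (\<bar>f x\<bar> / lam * (ln (exp 1 + \<bar>f x\<bar> / lam)) ^ (m - 2)) \<partial>(leb m ds))"
    unfolding level I by simp
qed

end
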